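(* Let $D$ be an AGCD domain that is also a URD. Then the following statements are equivalent. (1) $D$ is a locally finite intersection of rank-one valuation domains. (2) $D$ is an intersection of rank-one valuation domains. (3) $D$ is completely integrally closed. (4) $D[[X]]$ is integrally closed. (5) $D$ is integrally closed and Archimedean. (6) $D$ is integrally closed and every packet of $D$ is contained in a height-one prime ideal of $D$. (7) $D$ is an almost GUFD.
   Context: $D$ is an integral domain with quotient field $K$. $D$ is an almost GCD (AGCD) domain if for all nonzero $a,b\in D$ there is an integer $n\ge1$ such that $(a^n)\cap(b^n)$ is principal. For a nonzero fractional ideal $I$ put $I^{-1}=\{x\in K\mid xI\subseteq D\}$, $I_v=(I^{-1})^{-1}$, and $I_t=\bigcup\{J_v\mid J\subseteq I,\ J \text{ a nonzero finitely generated fractional ideal}\}$. $I$ is a $t$-ideal if $I_t=I$, and $t$-invertible if $(II^{-1})_t=D$. A packet of $D$ is an (integral) $t$-invertible $t$-ideal of $D$ whose radical is a prime ideal. $D$ is a unique representation domain (URD) if every proper $t$-invertible $t$-ideal $I$ of $D$ can be uniquely (up to order) expressed as a $t$-product $I=(I_1\cdots I_m)_t$ of pairwise $t$-comaximal packets, where $I_i,I_j$ are $t$-comaximal if $(I_i+I_j)_t=D$. $D$ is Archimedean if $\bigcap_{n=1}^{\infty}(x^n)=(0)$ for every nonunit $x\in D$. $D$ is completely integrally closed if whenever $x\in K$ and $0\ne r\in D$ satisfy $rx^n\in D$ for every integer $n\ge1$, then $x\in D$. Intersections of valuation domains are intersections of valuation overrings of $D$ in $K$ (the empty intersection is $K$);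 such an intersection is locally finite if every nonzero nonunit of $D$ is a nonunit in only finitely many of the valuation domains. $D$ is a generalized Krull domain if it is a locally finite intersection of essential rank-one valuation domains, i.e. rank-one valuation domains of the form $D_P$ with $P$ a prime ideal of $D$. The $t$-class group $Cl_t(D)$ is the group of $t$-invertible fractional $t$-ideals under $I\ast J=(IJ)_t$ modulo its subgroup of nonzero principal fractional ideals. $D$ is an almost GUFD if $D$ is a generalized Krull domain and $Cl_t(D)$ is a torsion group. *)

theory Defs
  imports
    "HOL-Computational_Algebra.Formal_Laurent_Series"
    "HOL-Library.Multiset"
    "HOL-Library.Extended_Nat"
    "HOL-Algebra.Coset"
begin

text \<open>
  Integral domains are unital subrings \<open>R\<close> of a field type \<open>'k\<close>. The ring \<open>D\<close> under study has
  quotient field \<open>quotient_field D = UNIV\<close>, so its fractional ideals and its overrings in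
  \<open>K\<close> are sets of elements of \<open>'k\<close>, and \<open>\<Inter>{} = UNIV\<close> is the empty intersection of overrings.
\<close>

definition is_subring :: "'k::field set \<Rightarrow> bool" where
  "is_subring R \<longleftrightarrow> 1 \<in> R \<and> (\<forall>a\<in>R. \<forall>b\<in>R. a - b \<in> R \<and> a * b \<in> R)"

definition quotient_field :: "'k::field set \<Rightarrow> 'k set" where
  "quotient_field R = {a / b | a b. a \<in> R \<and> b \<in> R \<and> b \<noteq> 0}"

definition is_unit_in :: "'k::field set \<Rightarrow> 'k \<Rightarrow> bool" where
  "is_unit_in R x \<longleftrightarrow> x \<in> R \<and> (\<exists>y\<in>R. x * y = 1)"

definition is_submodule :: "'k::field set \<Rightarrow> 'k set \<Rightarrow> bool" where
  "is_submodule R I \<longleftrightarrow>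
     0 \<in> I \<and> (\<forall>x\<in>I. \<forall>y\<in>I. x + y \<in> I) \<and> (\<forall>r\<in>R. \<forall>x\<in>I. r * x \<in> I)"

definition is_ideal :: "'k::field set \<Rightarrow> 'k set \<Rightarrow> bool" where
  "is_ideal R I \<longleftrightarrow> is_submodule R I \<and> I \<subseteq> R"

definition is_prime_ideal :: "'k::field set \<Rightarrow> 'k set \<Rightarrow> bool" where
  "is_prime_ideal R P \<longleftrightarrow>
     is_ideal R P \<and> P \<noteq> R \<and> (\<forall>a\<in>R. \<forall>b\<in>R. a * b \<in> P \<longrightarrow> a \<in> P \<or> b \<in> P)"

definition radical :: "'k::field set \<Rightarrow> 'k set \<Rightarrow> 'k set" where
  "radical R I = {x \<in> R. \<exists>n\<ge>1. x ^ n \<in> I}"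

definition principal :: "'k::field set \<Rightarrow> 'k \<Rightarrow> 'k set" where
  "principal R c = {c * r | r. r \<in> R}"

text \<open>Supremum of the lengths of the chains of primes ending in \<open>P\<close>; a chain of \<open>n + 1\<close> primes has length \<open>n\<close>.\<close>
definition height :: "'k::field set \<Rightarrow> 'k set \<Rightarrow> enat" where
  "height R P =
     (SUP Ps \<in> {Ps. Ps \<noteq> [] \<and> last Ps = P \<and> sorted_wrt (\<subset>) Ps \<and> (\<forall>Q\<in>set Ps. is_prime_ideal R Q)}.
        enat (length Ps - 1))"

definition krull_dim :: "'k::field set \<Rightarrow> enat" where
  "krull_dim R = (SUP P \<in> {P. is_prime_ideal R P}. height R P)"

definition localization :: "'k::field set \<Rightarrow> 'k set \<Rightarrow> 'k set" where
  "localization R P = {a / b | a b. a \<in> R \<and> b \<in> R - P}"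

definition is_fractional_ideal :: "'k::field set \<Rightarrow> 'k set \<Rightarrow> bool" where
  "is_fractional_ideal D I \<longleftrightarrow>
     is_submodule D I \<and> (\<exists>d\<in>D. d \<noteq> 0 \<and> (\<forall>x\<in>I. d * x \<in> D))"

definition is_nonzero_frac_ideal :: "'k::field set \<Rightarrow> 'k set \<Rightarrow> bool" where
  "is_nonzero_frac_ideal D I \<longleftrightarrow> is_fractional_ideal D I \<and> I \<noteq> {0}"

definition is_finitely_generated :: "'k::field set \<Rightarrow> 'k set \<Rightarrow> bool" where
  "is_finitely_generated D I \<longleftrightarrow> (\<exists>S. finite S \<and> I = is_submodule D hull S)"

definition ideal_sum :: "'k::field set \<Rightarrow> 'k set \<Rightarrow> 'k set" where
  "ideal_sum I J = {a + b | a b. a \<in> I \<and> b \<in> J}"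

definition ideal_mult :: "'k::field set \<Rightarrow> 'k set \<Rightarrow> 'k set \<Rightarrow> 'k set" where
  "ideal_mult D I J = is_submodule D hull {a * b | a b. a \<in> I \<and> b \<in> J}"

definition ideal_inverse :: "'k::field set \<Rightarrow> 'k set \<Rightarrow> 'k set" where
  "ideal_inverse D I = {x. \<forall>y\<in>I. x * y \<in> D}"

definition v_closure :: "'k::field set \<Rightarrow> 'k set \<Rightarrow> 'k set" where
  "v_closure D I = ideal_inverse D (ideal_inverse D I)"

definition t_closure :: "'k::field set \<Rightarrow> 'k set \<Rightarrow> 'k set" where
  "t_closure D I =
     \<Union>{v_closure D J | J. J \<subseteq> I \<and> is_nonzero_frac_ideal D J \<and> is_finitely_generated D J}"

definition is_t_ideal :: "'k::field set \<Rightarrow> 'k set \<Rightarrow> bool" where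
  "is_t_ideal D I \<longleftrightarrow> is_nonzero_frac_ideal D I \<and> t_closure D I = I"

definition is_t_invertible :: "'k::field set \<Rightarrow> 'k set \<Rightarrow> bool" where
  "is_t_invertible D I \<longleftrightarrow>
     is_nonzero_frac_ideal D I \<and> t_closure D (ideal_mult D I (ideal_inverse D I)) = D"

definition t_comaximal :: "'k::field set \<Rightarrow> 'k set \<Rightarrow> 'k set \<Rightarrow> bool" where
  "t_comaximal D I J \<longleftrightarrow> t_closure D (ideal_sum I J) = D"

definition is_packet :: "'k::field set \<Rightarrow> 'k set \<Rightarrow> bool" where
  "is_packet D I \<longleftrightarrow>
     I \<subseteq> D \<and> is_t_ideal D I \<and> is_t_invertible D I \<and> is_prime_ideal D (radical D I)"

text \<open>The seed \<open>D\<close> of the product is neutral: \<open>ideal_mult D J D = J\<close> for every submodule \<open>J\<close>.\<close>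
definition is_packet_representation :: "'k::field set \<Rightarrow> 'k set \<Rightarrow> 'k set list \<Rightarrow> bool" where
  "is_packet_representation D I Is \<longleftrightarrow>
     Is \<noteq> [] \<and> (\<forall>J\<in>set Is. is_packet D J) \<and>
     (\<forall>i<length Is. \<forall>j<length Is. i \<noteq> j \<longrightarrow> t_comaximal D (Is ! i) (Is ! j)) \<and>
     I = t_closure D (foldr (ideal_mult D) Is D)"

definition is_URD :: "'k::field set \<Rightarrow> bool" where
  "is_URD D \<longleftrightarrow>
     (\<forall>I. I \<subset> D \<and> is_t_ideal D I \<and> is_t_invertible D I \<longrightarrow>
        (\<exists>Is. is_packet_representation D I Is) \<and>
        (\<forall>Is Js. is_packet_representation D I Is \<and> is_packet_representation D I Js
            \<longrightarrow> mset Is = mset Js))"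

definition is_AGCD :: "'k::field set \<Rightarrow> bool" where
  "is_AGCD D \<longleftrightarrow>
     (\<forall>a\<in>D - {0}. \<forall>b\<in>D - {0}. \<exists>n\<ge>1. \<exists>c\<in>D.
        principal D (a ^ n) \<inter> principal D (b ^ n) = principal D c)"

definition is_archimedean :: "'k::field set \<Rightarrow> bool" where
  "is_archimedean D \<longleftrightarrow>
     (\<forall>x\<in>D. \<not> is_unit_in D x \<longrightarrow> (\<Inter>n\<in>{1..}. principal D (x ^ n)) = {0})"

definition is_integral_over :: "'k::field set \<Rightarrow> 'k \<Rightarrow> bool" where
  "is_integral_over R x \<longleftrightarrow>
     (\<exists>p. lead_coeff p = 1 \<and> (\<forall>i. coeff p i \<in> R) \<and> poly p x = 0)"

definition is_integrally_closed :: "'k::field set \<Rightarrow> bool" where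
  "is_integrally_closed R \<longleftrightarrow> (\<forall>x\<in>quotient_field R. is_integral_over R x \<longrightarrow> x \<in> R)"

definition is_completely_integrally_closed :: "'k::field set \<Rightarrow> bool" where
  "is_completely_integrally_closed R \<longleftrightarrow>
     (\<forall>x\<in>quotient_field R. \<forall>r\<in>R. r \<noteq> 0 \<and> (\<forall>n\<ge>1. r * x ^ n \<in> R) \<longrightarrow> x \<in> R)"

text \<open>
  \<open>D[[X]]\<close>, viewed inside the field \<open>K((X))\<close> of Laurent series. The quotient field of \<open>D[[X]]\<close>
  is in general a proper subfield of \<open>K((X))\<close>; \<open>is_integrally_closed\<close> refers to that subfield.
\<close>
definition power_series_ring :: "'k::field set \<Rightarrow> 'k fls set" where
  "power_series_ring D = fps_to_fls ` {f. \<forall>n. fps_nth f n \<in> D}"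

definition is_valuation_overring :: "'k::field set \<Rightarrow> 'k set \<Rightarrow> bool" where
  "is_valuation_overring D V \<longleftrightarrow>
     is_subring V \<and> D \<subseteq> V \<and> (\<forall>x. x \<noteq> 0 \<longrightarrow> x \<in> V \<or> inverse x \<in> V)"

text \<open>The rank of a valuation domain is its Krull dimension.\<close>
definition is_rank_one_valuation_overring :: "'k::field set \<Rightarrow> 'k set \<Rightarrow> bool" where
  "is_rank_one_valuation_overring D V \<longleftrightarrow> is_valuation_overring D V \<and> krull_dim V = 1"

definition is_essential_overring :: "'k::field set \<Rightarrow> 'k set \<Rightarrow> bool" where
  "is_essential_overring D V \<longleftrightarrow> (\<exists>P. is_prime_ideal D P \<and> V = localization D P)"

definition is_locally_finite :: "'k::field set \<Rightarrow> 'k set set \<Rightarrow> bool" where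
  "is_locally_finite D \<V> \<longleftrightarrow>
     (\<forall>x\<in>D. x \<noteq> 0 \<and> \<not> is_unit_in D x \<longrightarrow> finite {V \<in> \<V>. \<not> is_unit_in V x})"

definition is_generalized_Krull :: "'k::field set \<Rightarrow> bool" where
  "is_generalized_Krull D \<longleftrightarrow>
     (\<exists>\<V>. (\<forall>V\<in>\<V>. is_rank_one_valuation_overring D V \<and> is_essential_overring D V) \<and>
          D = \<Inter>\<V> \<and> is_locally_finite D \<V>)"

definition t_ideal_group :: "'k::field set \<Rightarrow> 'k set monoid" where
  "t_ideal_group D =
     \<lparr>carrier = {I. is_t_ideal D I \<and> is_t_invertible D I},
      mult = (\<lambda>I J. t_closure D (ideal_mult D I J)),
      one = D\<rparr>"

definition t_class_group :: "'k::field set \<Rightarrow> 'k set set monoid" where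
  "t_class_group D = t_ideal_group D Mod {principal D c | c. c \<noteq> 0}"

definition is_torsion_group :: "('g, 'b) monoid_scheme \<Rightarrow> bool" where
  "is_torsion_group G \<longleftrightarrow>
     group G \<and> (\<forall>x\<in>carrier G. \<exists>n\<ge>1. x [^]\<^bsub>G\<^esub> (n::nat) = \<one>\<^bsub>G\<^esub>)"

definition is_almost_GUFD :: "'k::field set \<Rightarrow> bool" where
  "is_almost_GUFD D \<longleftrightarrow> is_generalized_Krull D \<and> is_torsion_group (t_class_group D)"

end

theory Submission
  imports Defs
begin

text \<open>
  The implications run in the cycle (1), (2), \<dots>, (7), (1). A rank-one valuation ring is completely
  integrally closed, this property passes to intersections and to \<open>D[[X]]\<close>, and it implies being
  integrally closed. If \<open>D[[X]]\<close> is integrally closed, a suitable integral equation over it shows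
  that \<open>D\<close> is Archimedean.

  In an integrally closed AGCD domain any finitely many elements have a greatest common divisor
  after raising them to a common power. Hence every \<open>t\<close>-invertible \<open>t\<close>-ideal has a principal
  \<open>t\<close>-power, and every fraction has a power \<open>u / v\<close> with \<open>u\<close> and \<open>v\<close> coprime. Two coprime elements lie
  neither in the radical of a common packet nor in a common prime of height one, which gives both
  the minimality of the radicals of packets in the Archimedean case and the representation of \<open>D\<close> as
  the intersection of the valuation rings \<open>D\<^sub>P\<close>, \<open>P\<close> of height one. Only finitely many such \<open>P\<close> contain
  a given nonzero \<open>x\<close>: each is the radical of one of the packets whose \<open>t\<close>-product is \<open>(x)\<close>.
\<close>

section \<open>Subrings of a field, prime ideals and localizations\<close>

text \<open>In an AGCD domain two elements need not have a greatest common divisor; only suitable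
  powers do, and the exponent varies with the elements. Divisibility is therefore argued for powers,
  and integral closedness brings the result back: \<open>x ^ n \<in> D\<close> implies
  \<open>x \<in> D\<close>. Coprimality of \<open>u\<close>, \<open>v\<close> is taken in the form
  \<open>1 \<in> v_closure D {u, v}\<close>, that is, y u \<in> D and y v \<in> D imply y \<in> D;
  for elements of \<open>D\<close> this survives raising to powers. The Archimedean property
  concerns elements while packets are ideals. The bridge is the generator \<open>q\<close> of a
  principal \<open>t\<close>-power of a packet: it lies in the packet and has the same radical, so
  powers of \<open>q\<close> can be compared with an element of a smaller prime. Every nonzero
  nonunit lies in a packet, so an element is shown to be a unit by excluding it from all
  packets.\<close>

lemma subring_one: "is_subring R \<Longrightarrow> 1 \<in> R"
  by (simp add: is_subring_def)

lemma subring_diff: "is_subring R \<Longrightarrow> a \<in> R \<Longrightarrow> b \<in> R \<Longrightarrow> a - b \<in> R"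
  by (simp add: is_subring_def)

lemma subring_mult: "is_subring R \<Longrightarrow> a \<in> R \<Longrightarrow> b \<in> R \<Longrightarrow> a * b \<in> R"
  by (simp add: is_subring_def)

lemma subring_zero: "is_subring R \<Longrightarrow> 0 \<in> R"
  using subring_diff[OF _ subring_one subring_one, of R] by simp

lemma subring_uminus: "is_subring R \<Longrightarrow> a \<in> R \<Longrightarrow> - a \<in> R"
  using subring_diff[OF _ subring_zero, of R a] by simp

lemma subring_add: "is_subring R \<Longrightarrow> a \<in> R \<Longrightarrow> b \<in> R \<Longrightarrow> a + b \<in> R"
  using subring_diff[OF _ _ subring_uminus, of R a b] by simp

lemma subring_power: "is_subring R \<Longrightarrow> a \<in> R \<Longrightarrow> a ^ n \<in> R"
  by (induction n) (auto simp: subring_one subring_mult)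

lemma subring_sum: "is_subring R \<Longrightarrow> (\<And>i. i \<in> A \<Longrightarrow> f i \<in> R) \<Longrightarrow> sum f A \<in> R"
  by (induction A rule: infinite_finite_induct) (auto simp: subring_zero subring_add)

lemma subring_prod_list: "is_subring R \<Longrightarrow> set xs \<subseteq> R \<Longrightarrow> prod_list xs \<in> R"
  by (induction xs) (auto simp: subring_one subring_mult)

lemma subring_of_nat: "is_subring R \<Longrightarrow> of_nat n \<in> R"
  by (induction n) (auto simp: subring_zero subring_one subring_add)

lemmas subring_closed = subring_one subring_zero subring_diff subring_mult subring_add
  subring_uminus subring_power

lemma in_principal_iff: "c \<noteq> 0 \<Longrightarrow> x \<in> principal R c \<longleftrightarrow> x / c \<in> R"
proof
  assume "c \<noteq> 0" "x / c \<in> R"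
  moreover from \<open>c \<noteq> 0\<close> have "x = c * (x / c)"
    by simp
  ultimately show "x \<in> principal R c"
    unfolding principal_def by blast
qed (auto simp: principal_def)

lemma prime_ideal_subset: "is_prime_ideal R P \<Longrightarrow> P \<subseteq> R"
  by (auto simp: is_prime_ideal_def is_ideal_def)

lemma submodule_zero: "is_submodule R I \<Longrightarrow> 0 \<in> I"
  by (simp add: is_submodule_def)

lemma submodule_add: "is_submodule R I \<Longrightarrow> x \<in> I \<Longrightarrow> y \<in> I \<Longrightarrow> x + y \<in> I"
  by (simp add: is_submodule_def)

lemma submodule_mult: "is_submodule R I \<Longrightarrow> r \<in> R \<Longrightarrow> x \<in> I \<Longrightarrow> r * x \<in> I"
  by (simp add: is_submodule_def)

lemma prime_ideal_zero: "is_prime_ideal R P \<Longrightarrow> 0 \<in> P"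
  by (auto simp: is_prime_ideal_def is_ideal_def is_submodule_def)

lemma prime_ideal_add: "is_prime_ideal R P \<Longrightarrow> a \<in> P \<Longrightarrow> b \<in> P \<Longrightarrow> a + b \<in> P"
  by (auto simp: is_prime_ideal_def is_ideal_def is_submodule_def)

lemma prime_ideal_mult_left: "is_prime_ideal R P \<Longrightarrow> r \<in> R \<Longrightarrow> a \<in> P \<Longrightarrow> r * a \<in> P"
  by (auto simp: is_prime_ideal_def is_ideal_def is_submodule_def)

lemma prime_ideal_mult_right: "is_prime_ideal R P \<Longrightarrow> r \<in> R \<Longrightarrow> a \<in> P \<Longrightarrow> a * r \<in> P"
  by (metis mult.commute prime_ideal_mult_left)

lemma prime_ideal_cases:
  "is_prime_ideal R P \<Longrightarrow> a * b \<in> P \<Longrightarrow> a \<in> R \<Longrightarrow> b \<in> R \<Longrightarrow> a \<in> P \<or> b \<in> P"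
  by (auto simp: is_prime_ideal_def)

lemma prime_ideal_one: "is_prime_ideal R P \<Longrightarrow> 1 \<notin> P"
  using prime_ideal_mult_right[of R P _ 1] prime_ideal_subset[of R P]
  by (auto simp: is_prime_ideal_def)

lemma prime_ideal_power:
  assumes "is_subring R" "is_prime_ideal R P" "a \<in> R" "a ^ n \<in> P"
  shows "a \<in> P"
  using assms(4)
proof (induction n)
  case (Suc n)
  then show ?case
    using prime_ideal_cases[of R P a "a ^ n"] assms subring_power by auto
qed (use assms prime_ideal_one in auto)

lemma prime_ideal_compl_mult:
  "is_subring R \<Longrightarrow> is_prime_ideal R P \<Longrightarrow> a \<in> R - P \<Longrightarrow> b \<in> R - P \<Longrightarrow> a * b \<in> R - P"
  using prime_ideal_cases subring_mult by fastforce

lemma radical_subset_prime: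
  assumes "is_subring R" "is_prime_ideal R P" "I \<subseteq> P"
  shows "radical R I \<subseteq> P"
  using assms prime_ideal_power by (fastforce simp: radical_def)

lemma subset_radical: "I \<subseteq> R \<Longrightarrow> I \<subseteq> radical R I"
  by (auto simp: radical_def intro!: exI[of _ 1])

lemma prime_ideal_unit:
  assumes "is_prime_ideal R P" "x \<in> P"
  shows "\<not> is_unit_in R x"
  using assms prime_ideal_mult_right[OF assms(1) _ assms(2)] prime_ideal_one[of R P]
  unfolding is_unit_in_def by metis

lemma zero_prime_ideal:
  assumes "is_subring R"
  shows "is_prime_ideal R {0}"
  using assms subring_one[OF assms]
  by (auto simp: is_prime_ideal_def is_ideal_def is_submodule_def subring_zero)

text \<open>Krull's argument: an ideal that is maximal among those containing \<open>I\<close> and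
  disjoint from the multiplicative set \<open>S\<close> is prime. With \<open>S = {1}\<close> this
  gives a prime above any proper ideal.\<close>

lemma exists_prime_ideal_avoiding:
  assumes R: "is_subring R" and I: "is_ideal R I"
    and S: "1 \<in> S" "\<And>a b. a \<in> S \<Longrightarrow> b \<in> S \<Longrightarrow> a * b \<in> S" and IS: "I \<inter> S = {}"
  shows "\<exists>Q. is_prime_ideal R Q \<and> I \<subseteq> Q \<and> Q \<inter> S = {}"
proof -
  define F where "F = {J. is_ideal R J \<and> I \<subseteq> J \<and> J \<inter> S = {}}"
  have "I \<in> F"
    using I IS by (simp add: F_def)
  moreover have "\<Union>C \<in> F" if C: "C \<noteq> {}" "subset.chain F C" for C
  proof -
    have C_F: "is_ideal R J" "I \<subseteq> J" "J \<inter> S = {}" if "J \<in> C" for J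
      using that C(2) by (auto simp: subset.chain_def F_def)
    have pair: "\<exists>J\<in>C. x \<in> J \<and> y \<in> J" if "x \<in> \<Union>C" "y \<in> \<Union>C" for x y
      using that C(2) unfolding subset_chain_def by blast
    have "is_submodule R (\<Union>C)"
      unfolding is_submodule_def
    proof (intro conjI ballI)
      show "0 \<in> \<Union>C"
        using C(1) C_F(1) unfolding is_ideal_def is_submodule_def by blast
    next
      fix x y assume "x \<in> \<Union>C" "y \<in> \<Union>C"
      then obtain J where "J \<in> C" "x \<in> J" "y \<in> J"
        using pair by blast
      then show "x + y \<in> \<Union>C"
        using C_F(1)[of J] submodule_add[of R J x y] by (auto simp: is_ideal_def)
    next
      fix r x assume "r \<in> R" "x \<in> \<Union>C"
      then show "r * x \<in> \<Union>C"
        using C_F(1) submodule_mult by (fastforce simp: is_ideal_def)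
    qed
    moreover have "\<Union>C \<subseteq> R" "I \<subseteq> \<Union>C" "\<Union>C \<inter> S = {}"
      using C(1) C_F unfolding is_ideal_def by blast+
    ultimately show ?thesis
      by (simp add: F_def is_ideal_def)
  qed
  ultimately obtain Q where Q: "Q \<in> F" and max: "\<And>J. J \<in> F \<Longrightarrow> Q \<subseteq> J \<Longrightarrow> J = Q"
    using subset_Zorn_nonempty[of F] by blast
  have QI: "is_submodule R Q" "Q \<subseteq> R" "I \<subseteq> Q" "Q \<inter> S = {}"
    using Q by (auto simp: F_def is_ideal_def)
  \<comment> \<open>By maximality the larger ideal Q + R a must meet \<open>S\<close>.\<close>
  have meets: "\<exists>q\<in>Q. \<exists>r\<in>R. q + r * a \<in> S" if a: "a \<in> R" "a \<notin> Q" for a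
  proof (rule ccontr)
    assume none: "\<not> (\<exists>q\<in>Q. \<exists>r\<in>R. q + r * a \<in> S)"
    define J where "J = {q + r * a | q r. q \<in> Q \<and> r \<in> R}"
    have "x \<in> J" if "x \<in> Q" for x
      using that R subring_zero unfolding J_def by force
    moreover have "a \<in> J"
      using R subring_one submodule_zero[OF QI(1)] unfolding J_def by force
    moreover have "is_ideal R J"
      unfolding is_ideal_def is_submodule_def
    proof (intro conjI ballI)
      show "0 \<in> J"
        using calculation submodule_zero[OF QI(1)] by blast
    next
      fix x y assume "x \<in> J" "y \<in> J"
      then obtain q r q' r' where "x = q + r * a" "y = q' + r' * a"
        "q \<in> Q" "q' \<in> Q" "r \<in> R" "r' \<in> R"
        unfolding J_def by blast
      then have "x + y = (q + q') + (r + r') * a" "q + q' \<in> Q" "r + r' \<in> R"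
        using R QI(1) by (auto simp: algebra_simps subring_add submodule_add)
      then show "x + y \<in> J"
        unfolding J_def by blast
    next
      fix s x assume "s \<in> R" "x \<in> J"
      then obtain q r where "x = q + r * a" "q \<in> Q" "r \<in> R"
        unfolding J_def by blast
      then have "s * x = s * q + (s * r) * a" "s * q \<in> Q" "s * r \<in> R"
        using R QI(1) \<open>s \<in> R\<close> by (simp_all add: distrib_left mult.assoc subring_mult submodule_mult)
      then show "s * x \<in> J"
        unfolding J_def by blast
    next
      show "J \<subseteq> R"
        using R QI(2) a(1) by (auto simp: J_def subring_closed subset_iff)
    qed
    moreover have "J \<inter> S = {}"
      using none by (auto simp: J_def)
    ultimately show False
      using max[of J] QI(3) a(2) by (auto simp: F_def)
  qed
  have "a \<in> Q \<or> b \<in> Q" if ab: "a \<in> R" "b \<in> R" "a * b \<in> Q" for a b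
  proof (rule ccontr)
    assume "\<not> (a \<in> Q \<or> b \<in> Q)"
    then obtain q r q' r' where h: "q \<in> Q" "r \<in> R" "q + r * a \<in> S" "q' \<in> Q" "r' \<in> R" "q' + r' * b \<in> S"
      using meets ab by metis
    \<comment> \<open>If a b is in \<open>Q\<close>, then so is this product of two elements of
      \<open>S\<close>: every term contains \<open>q\<close>, \<open>q'\<close> or
      \<open>a * b\<close>.\<close>
    have "(q + r * a) * (q' + r' * b) = (q' + r' * b) * q + ((r * a) * q' + (r * r') * (a * b))"
      by (simp add: algebra_simps)
    also have "\<dots> \<in> Q"
    proof (intro submodule_add[OF QI(1)])
      show "(q' + r' * b) * q \<in> Q" "(r * a) * q' \<in> Q" "(r * r') * (a * b) \<in> Q"
        using h ab QI(2) subring_add[OF R] subring_mult[OF R]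
        by (simp_all add: submodule_mult[OF QI(1)] subset_iff)
    qed
    finally show False
      using S(2)[OF h(3) h(6)] QI(4) by blast
  qed
  moreover have "Q \<noteq> R"
    using QI(4) S(1) subring_one[OF R] by blast
  ultimately show ?thesis
    using QI unfolding is_prime_ideal_def is_ideal_def by blast
qed

section \<open>Height and Krull dimension\<close>

lemma height_le_one:
  assumes "\<And>Q. is_prime_ideal R Q \<Longrightarrow> Q \<noteq> {0} \<Longrightarrow> Q \<subset> P \<Longrightarrow> False"
  shows "height R P \<le> 1"
  unfolding height_def
proof (rule SUP_least, clarify)
  fix Ps assume Ps: "Ps \<noteq> []" "P = last Ps" "sorted_wrt (\<subset>) Ps" "\<forall>Q\<in>set Ps. is_prime_ideal R Q"
  show "enat (length Ps - 1) \<le> 1"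
  proof (rule ccontr)
    assume "\<not> ?thesis"
    then have len: "length Ps \<ge> 3"
      by (simp add: one_enat_def)
    let ?n = "length Ps"
    have chain: "Ps ! (?n - 3) \<subset> Ps ! (?n - 2)" "Ps ! (?n - 2) \<subset> Ps ! (?n - 1)"
      using Ps(3) len by (auto simp: sorted_wrt_iff_nth_less)
    have primes: "is_prime_ideal R (Ps ! (?n - 3))" "is_prime_ideal R (Ps ! (?n - 2))"
      using Ps(4) len by auto
    \<comment> \<open>A prime that strictly contains another prime is nonzero, so the last but one
      member of a chain of at least three primes lies strictly between {0} and
      \<open>P\<close>.\<close>
    have "Ps ! (?n - 2) \<noteq> {0}"
      using chain(1) prime_ideal_zero[OF primes(1)] by auto
    moreover have "P = Ps ! (?n - 1)"
      using Ps(1,2) by (simp add: last_conv_nth)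
    ultimately show False
      using assms[OF primes(2)] chain(2) by simp
  qed
qed

lemma height_eq_one:
  assumes R: "is_subring R" and P: "is_prime_ideal R P" "P \<noteq> {0}"
    and min: "\<And>Q. is_prime_ideal R Q \<Longrightarrow> Q \<noteq> {0} \<Longrightarrow> Q \<subset> P \<Longrightarrow> False"
  shows "height R P = 1"
proof (rule antisym)
  show "1 \<le> height R P"
    unfolding height_def
  proof (rule SUP_upper2)
    show "[{0}, P] \<in> {Ps. Ps \<noteq> [] \<and> last Ps = P \<and> sorted_wrt (\<subset>) Ps \<and> (\<forall>Q\<in>set Ps. is_prime_ideal R Q)}"
      using P prime_ideal_zero[OF P(1)] zero_prime_ideal[OF R] by auto
  qed (simp add: one_enat_def)
qed (use height_le_one min in blast)

lemma height_ge_two: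
  assumes "is_subring R" "is_prime_ideal R P" "is_prime_ideal R Q" "Q \<noteq> {0}" "Q \<subset> P"
  shows "2 \<le> height R P"
  unfolding height_def
proof (rule SUP_upper2)
  show "[{0}, Q, P] \<in> {Ps. Ps \<noteq> [] \<and> last Ps = P \<and> sorted_wrt (\<subset>) Ps \<and> (\<forall>Q\<in>set Ps. is_prime_ideal R Q)}"
    using assms prime_ideal_zero[of R] zero_prime_ideal by auto
qed (simp add: numeral_eq_enat)

lemma krull_dim_eq_one:
  assumes R: "is_subring R" and P: "is_prime_ideal R P" "P \<noteq> {0}"
    and min: "\<And>P Q. is_prime_ideal R P \<Longrightarrow> is_prime_ideal R Q \<Longrightarrow> Q \<noteq> {0} \<Longrightarrow> Q \<subset> P \<Longrightarrow> False"
  shows "krull_dim R = 1"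
proof (rule antisym)
  show "krull_dim R \<le> 1"
    unfolding krull_dim_def by (rule SUP_least, rule height_le_one) (use min in blast)
  have "height R P = 1"
    using P(1) min by (intro height_eq_one[OF R P]) blast
  then show "1 \<le> krull_dim R"
    unfolding krull_dim_def using P(1) by (intro SUP_upper2[of P]) simp_all
qed

lemma krull_dim_oneD:
  assumes "is_subring R" "krull_dim R = 1" "is_prime_ideal R P" "is_prime_ideal R Q" "Q \<noteq> {0}"
  shows "\<not> Q \<subset> P"
proof
  assume "Q \<subset> P"
  then have "2 \<le> height R P"
    using assms height_ge_two by blast
  also have "\<dots> \<le> krull_dim R"
    unfolding krull_dim_def using assms(3) by (intro SUP_upper) auto
  finally show False
    using assms(2) by (simp add: numeral_eq_enat one_enat_def)
qed

section \<open>Localization at a prime ideal\<close>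

lemma localization_subring:
  assumes R: "is_subring R" and P: "is_prime_ideal R P"
  shows "is_subring (localization R P)"
proof -
  have nz: "b \<noteq> 0" if "b \<in> R - P" for b
    using that P prime_ideal_zero by blast
  have mem: "a / b \<in> localization R P" if "a \<in> R" "b \<in> R - P" for a b
    using that unfolding localization_def by blast
  show ?thesis
    unfolding is_subring_def
  proof (intro conjI ballI)
    show "1 \<in> localization R P"
      using mem[of 1 1] subring_one[OF R] prime_ideal_one[OF P] by simp
  next
    fix x y assume "x \<in> localization R P" "y \<in> localization R P"
    then obtain a b c d where xy: "x = a / b" "y = c / d" "a \<in> R" "b \<in> R - P" "c \<in> R" "d \<in> R - P"
      unfolding localization_def by blast
    have eq: "x - y = (a * d - c * b) / (b * d)" "x * y = (a * c) / (b * d)"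
      using nz[OF xy(4)] nz[OF xy(6)] by (simp_all add: xy(1,2) diff_frac_eq)
    have "a * d - c * b \<in> R" "a * c \<in> R"
      using xy(3-6) by (simp_all add: subring_diff[OF R] subring_mult[OF R])
    then show "x - y \<in> localization R P" "x * y \<in> localization R P"
      unfolding eq using prime_ideal_compl_mult[OF R P xy(4) xy(6)] by (simp_all only: mem)
  qed
qed

lemma subset_localization:
  assumes "is_subring R" "is_prime_ideal R P"
  shows "R \<subseteq> localization R P"
proof
  fix x assume "x \<in> R"
  moreover have "x = x / 1" "1 \<in> R - P"
    using assms prime_ideal_one subring_one by auto
  ultimately show "x \<in> localization R P"
    unfolding localization_def by blast
qed

lemma inverse_in_localization:
  assumes "is_subring R" "s \<in> R - P"
  shows "1 / s \<in> localization R P"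
  using assms subring_one unfolding localization_def by blast

text \<open>The set is the extension P R_P. For primality, x y = p / s becomes s a c = p b d after
  clearing denominators, and s \<notin> P can be cancelled.\<close>

lemma extension_prime_ideal:
  assumes R: "is_subring R" and P: "is_prime_ideal R P"
  shows "is_prime_ideal (localization R P) {a / b | a b. a \<in> P \<and> b \<in> R - P}" (is "is_prime_ideal ?V ?M")
proof -
  have nz: "b \<noteq> 0" if "b \<in> R - P" for b
    using that P prime_ideal_zero by blast
  have one: "1 \<in> R - P"
    using R P prime_ideal_one subring_one by auto
  have M: "?M \<subseteq> ?V"
    using P prime_ideal_subset unfolding localization_def by blast
  have "0 \<in> ?M"
    using one prime_ideal_zero[OF P] by force
  moreover have "\<forall>x\<in>?M. \<forall>y\<in>?M. x + y \<in> ?M"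
  proof (intro ballI)
    fix x y assume "x \<in> ?M" "y \<in> ?M"
    then obtain a b c d where h: "x = a / b" "y = c / d" "a \<in> P" "b \<in> R - P" "c \<in> P" "d \<in> R - P"
      by blast
    then have "x + y = (a * d + c * b) / (b * d)"
      using nz by (auto simp: field_simps)
    moreover have "a * d + c * b \<in> P" "b * d \<in> R - P"
      using h prime_ideal_add[OF P] prime_ideal_mult_right[OF P] prime_ideal_compl_mult[OF R P] by auto
    ultimately show "x + y \<in> ?M"
      by blast
  qed
  ultimately have "is_submodule ?V ?M"
    unfolding is_submodule_def
  proof (intro conjI ballI)
    fix r x assume "r \<in> ?V" "x \<in> ?M"
    then obtain a b c d where h: "r = a / b" "x = c / d" "a \<in> R" "b \<in> R - P" "c \<in> P" "d \<in> R - P"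
      unfolding localization_def by blast
    moreover have "r * x = (a * c) / (b * d)" "a * c \<in> P" "b * d \<in> R - P"
      using h R P prime_ideal_compl_mult prime_ideal_mult_left by auto
    ultimately show "r * x \<in> ?M"
      by blast
  qed blast+
  moreover have "1 \<notin> ?M"
    using nz by auto
  moreover have "1 \<in> ?V"
    using localization_subring[OF R P] subring_one by blast
  moreover have "x \<in> ?M \<or> y \<in> ?M" if "x \<in> ?V" "y \<in> ?V" "x * y \<in> ?M" for x y
  proof -
    obtain a b c d p s where h: "x = a / b" "y = c / d" "x * y = p / s"
      "a \<in> R" "b \<in> R - P" "c \<in> R" "d \<in> R - P" "p \<in> P" "s \<in> R - P"
      using \<open>x \<in> ?V\<close> \<open>y \<in> ?V\<close> \<open>x * y \<in> ?M\<close> unfolding localization_def by blast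
    then have "s * (a * c) = p * (b * d)"
      using nz[of b] nz[of d] nz[of s] by (auto simp: field_simps)
    moreover have "p * (b * d) \<in> P"
      using h R by (intro prime_ideal_mult_right[OF P]) (auto simp: subring_closed)
    ultimately have "s * (a * c) \<in> P"
      by simp
    then have "a * c \<in> P"
      using prime_ideal_cases[OF P, of s "a * c"] h R by (auto simp: subring_closed)
    then have "a \<in> P \<or> c \<in> P"
      using prime_ideal_cases[OF P] h by blast
    then show ?thesis
      using h by blast
  qed
  ultimately show ?thesis
    using M unfolding is_prime_ideal_def is_ideal_def by blast
qed

lemma contraction_prime_ideal:
  assumes R: "is_subring R" and RV: "R \<subseteq> V" and N: "is_prime_ideal V N"
  shows "is_prime_ideal R (N \<inter> R)"
proof -
  have "N \<inter> R \<noteq> R"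
    using prime_ideal_one[OF N] subring_one[OF R] by blast
  moreover have "is_ideal R (N \<inter> R)"
    unfolding is_ideal_def is_submodule_def
    using prime_ideal_zero[OF N] prime_ideal_add[OF N] prime_ideal_mult_left[OF N] RV R
    by (auto simp: subring_closed subset_iff)
  moreover have "a \<in> N \<inter> R \<or> b \<in> N \<inter> R" if "a \<in> R" "b \<in> R" "a * b \<in> N \<inter> R" for a b
    using that prime_ideal_cases[OF N, of a b] RV by blast
  ultimately show ?thesis
    unfolding is_prime_ideal_def by blast
qed

lemma unit_in_localization_iff:
  assumes R: "is_subring R" and P: "is_prime_ideal R P" and x: "x \<in> R"
  shows "is_unit_in (localization R P) x \<longleftrightarrow> x \<notin> P"
proof
  assume "x \<notin> P"
  then have "x * (1 / x) = 1" "1 / x \<in> localization R P" "x \<in> localization R P"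
    using x inverse_in_localization[OF R, of x P] subset_localization[OF R P] prime_ideal_zero[OF P] by auto
  then show "is_unit_in (localization R P) x"
    unfolding is_unit_in_def by blast
next
  assume "is_unit_in (localization R P) x"
  moreover have "x \<in> {a / b | a b. a \<in> P \<and> b \<in> R - P}" if "x \<in> P"
  proof -
    have "x = x / 1" "1 \<in> R - P"
      using R P prime_ideal_one subring_one by auto
    then show ?thesis
      using that by blast
  qed
  ultimately show "x \<notin> P"
    using prime_ideal_unit[OF extension_prime_ideal[OF R P]] by blast
qed

text \<open>Height one without chains. The arguments below produce a nonzero prime inside
  \<open>P\<close> and conclude that it is \<open>P\<close>, for which this form is the direct
  one.\<close>

definition is_minimal_nonzero_prime :: "'k::field set \<Rightarrow> 'k set \<Rightarrow> bool" where
  "is_minimal_nonzero_prime R P \<longleftrightarrow>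
     is_prime_ideal R P \<and> P \<noteq> {0} \<and> (\<forall>Q. is_prime_ideal R Q \<longrightarrow> Q \<noteq> {0} \<longrightarrow> Q \<subseteq> P \<longrightarrow> Q = P)"

lemma minimal_nonzero_prime_height:
  assumes "is_subring R"
  shows "is_minimal_nonzero_prime R P \<longleftrightarrow> is_prime_ideal R P \<and> P \<noteq> {0} \<and> height R P = 1"
proof
  assume "is_minimal_nonzero_prime R P"
  then show "is_prime_ideal R P \<and> P \<noteq> {0} \<and> height R P = 1"
    using height_eq_one[OF assms, of P] unfolding is_minimal_nonzero_prime_def by blast
next
  assume *: "is_prime_ideal R P \<and> P \<noteq> {0} \<and> height R P = 1"
  have "\<not> (2::enat) \<le> 1"
    by (simp add: numeral_eq_enat one_enat_def)
  then show "is_minimal_nonzero_prime R P"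
    using * height_ge_two[OF assms, of P] unfolding is_minimal_nonzero_prime_def by auto
qed

text \<open>Every nonzero prime of R_P contracts to a nonzero prime inside \<open>P\<close>, hence
  to \<open>P\<close> itself by minimality, and a prime of a localization is determined by its
  contraction. So there is exactly one nonzero prime.\<close>

lemma localization_krull_dim_one:
  assumes R: "is_subring R" and P: "is_minimal_nonzero_prime R P"
  shows "krull_dim (localization R P) = 1"
proof -
  let ?V = "localization R P"
  have P': "is_prime_ideal R P" "P \<noteq> {0}"
    using P by (auto simp: is_minimal_nonzero_prime_def)
  note V = localization_subring[OF R P'(1)] and RV = subset_localization[OF R P'(1)]
  have nz: "b \<noteq> 0" if "b \<in> R - P" for b
    using that P' prime_ideal_zero by blast
  have contraction: "N \<inter> R = P" if N: "is_prime_ideal ?V N" "N \<noteq> {0}" for N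
  proof -
    have "N \<inter> R \<subseteq> P"
    proof
      fix x assume "x \<in> N \<inter> R"
      then show "x \<in> P"
        using unit_in_localization_iff[OF R P'(1)] prime_ideal_unit[OF N(1)] by blast
    qed
    moreover have "N \<inter> R \<noteq> {0}"
    proof -
      obtain x where x: "x \<in> N" "x \<noteq> 0"
        using N prime_ideal_zero by blast
      then obtain a b where ab: "x = a / b" "a \<in> R" "b \<in> R - P"
        using prime_ideal_subset[OF N(1)] unfolding localization_def by blast
      then have "a = b * x"
        using nz by auto
      moreover have "b \<in> ?V"
        using RV ab by blast
      ultimately have "a \<in> N" "a \<noteq> 0"
        using prime_ideal_mult_left[OF N(1) _ x(1)] nz[OF ab(3)] x(2) by auto
      then show ?thesis
        using ab by blast
    qed
    ultimately show ?thesis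
      using P contraction_prime_ideal[OF R RV N(1)] unfolding is_minimal_nonzero_prime_def by blast
  qed
  have "N' \<subseteq> N" if N: "is_prime_ideal ?V N" "N \<noteq> {0}" "is_prime_ideal ?V N'" "N' \<noteq> {0}" for N N'
  proof
    fix x assume x: "x \<in> N'"
    then obtain a b where ab: "x = a / b" "a \<in> R" "b \<in> R - P"
      using prime_ideal_subset[OF N(3)] unfolding localization_def by blast
    then have "a = b * x"
      using nz by auto
    moreover have "b \<in> ?V"
      using RV ab by blast
    ultimately have "a \<in> N'"
      using prime_ideal_mult_left[OF N(3) _ x] by auto
    then have "a \<in> N"
      using contraction[OF N(1,2)] contraction[OF N(3,4)] ab by blast
    then show "x \<in> N"
      using prime_ideal_mult_right[OF N(1) inverse_in_localization[OF R ab(3)]] ab by simp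
  qed
  then have "\<not> N \<subset> N'" if "is_prime_ideal ?V N" "N \<noteq> {0}" "is_prime_ideal ?V N'" for N N'
    using that prime_ideal_zero[of ?V N] by (metis empty_subsetI insert_subset psubsetE subset_antisym)
  moreover have "{a / b | a b. a \<in> P \<and> b \<in> R - P} \<noteq> {0}"
  proof -
    obtain a where "a \<in> P" "a \<noteq> 0"
      using P' prime_ideal_zero by blast
    then have "a / 1 \<in> {a / b | a b. a \<in> P \<and> b \<in> R - P}"
      using prime_ideal_one[OF P'(1)] subring_one[OF R] by blast
    then show ?thesis
      using \<open>a \<noteq> 0\<close> by auto
  qed
  ultimately show ?thesis
    by (intro krull_dim_eq_one[OF V extension_prime_ideal[OF R P'(1)]]) iprover+
qed

section \<open>Complete integral closure and power series\<close>

text \<open>If \<open>x \<notin> V\<close>, then y = 1 / x is a nonunit of \<open>V\<close> and the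
  intersection \<open>Q\<close> of all y^n V is a prime ideal without \<open>y\<close>. It contains
  \<open>r\<close>, so {0}, \<open>Q\<close> and a prime above \<open>y\<close> would form a chain
  of length two.\<close>

lemma rank_one_valuation_completely_integrally_closed:
  assumes V: "is_subring V" and val: "\<And>x. x \<noteq> 0 \<Longrightarrow> x \<in> V \<or> inverse x \<in> V"
    and dim: "krull_dim V = 1" and r: "r \<in> V" "r \<noteq> 0" "\<And>n. n \<ge> 1 \<Longrightarrow> r * x ^ n \<in> V"
  shows "x \<in> V"
proof (rule ccontr)
  assume x: "x \<notin> V"
  then have "x \<noteq> 0"
    using subring_zero[OF V] by auto
  define y where "y = inverse x"
  have y: "y \<in> V" "x * y = 1"
    using val[OF \<open>x \<noteq> 0\<close>] x \<open>x \<noteq> 0\<close> by (auto simp: y_def)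
  define Q where "Q = {z \<in> V. \<forall>n. z * x ^ n \<in> V}"
  have Q1: "1 \<notin> Q"
    using x by (auto simp: Q_def intro!: exI[of _ 1])
  have "is_submodule V Q"
    unfolding is_submodule_def Q_def
    using V by (auto simp: distrib_right mult.assoc subring_zero subring_add subring_mult)
  moreover have "a \<in> Q \<or> b \<in> Q" if ab: "a \<in> V" "b \<in> V" "a * b \<in> Q" for a b
  proof (rule ccontr)
    assume "\<not> (a \<in> Q \<or> b \<in> Q)"
    then obtain n m where nm: "a * x ^ n \<notin> V" "b * x ^ m \<notin> V"
      using ab by (auto simp: Q_def)
    then have "a * x ^ n \<noteq> 0" "b * x ^ m \<noteq> 0"
      using subring_zero[OF V] by metis+
    moreover from this have "inverse (a * x ^ n) \<in> V" "inverse (b * x ^ m) \<in> V"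
      using nm val by blast+
    moreover have "a * b * x ^ (n + m + 1) \<in> V"
      using ab(3) unfolding Q_def by blast
    \<comment> \<open>Both inverses lie in \<open>V\<close> because \<open>a * x ^ n\<close> and
      \<open>b * x ^ m\<close> do not; the additional 1 in the exponent n + m + 1 leaves exactly
      \<open>x\<close>.\<close>
    ultimately have "inverse (a * x ^ n) * inverse (b * x ^ m) * (a * b * x ^ (n + m + 1)) \<in> V"
      by (simp only: subring_mult[OF V])
    moreover have "inverse (a * x ^ n) * inverse (b * x ^ m) * (a * b * x ^ (n + m + 1)) = x"
      using \<open>a * x ^ n \<noteq> 0\<close> \<open>b * x ^ m \<noteq> 0\<close> by (simp add: field_simps power_add)
    ultimately show False
      using x by metis
  qed
  ultimately have Q_prime: "is_prime_ideal V Q"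
    using Q1 subring_one[OF V] unfolding is_prime_ideal_def is_ideal_def Q_def by blast
  have "is_ideal V (principal V y)"
    unfolding is_ideal_def is_submodule_def
  proof (intro conjI ballI)
    show "0 \<in> principal V y"
      using subring_zero[OF V] by (force simp: principal_def)
  next
    fix a b assume "a \<in> principal V y" "b \<in> principal V y"
    then obtain s t where "a = y * s" "b = y * t" "s \<in> V" "t \<in> V"
      by (auto simp: principal_def)
    then have "a + b = y * (s + t)" "s + t \<in> V"
      using V by (auto simp: distrib_left subring_add)
    then show "a + b \<in> principal V y"
      unfolding principal_def by blast
  next
    fix s a assume "s \<in> V" "a \<in> principal V y"
    then obtain t where "a = y * t" "t \<in> V"
      by (auto simp: principal_def)
    then have "s * a = y * (s * t)" "s * t \<in> V"
      using V \<open>s \<in> V\<close> by (auto simp: subring_mult)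
    then show "s * a \<in> principal V y"
      unfolding principal_def by blast
  next
    show "principal V y \<subseteq> V"
      using V y by (auto simp: principal_def subring_mult)
  qed
  moreover have "principal V y \<inter> {1} = {}"
  proof -
    have "y * s \<noteq> 1" if "s \<in> V" for s
    proof
      assume "y * s = 1"
      then have "s = x"
        using y(2) by (metis mult.commute mult.left_commute mult_1_right)
      then show False
        using that x by simp
    qed
    then show ?thesis
      by (fastforce simp: principal_def)
  qed
  ultimately obtain P where P: "is_prime_ideal V P" "principal V y \<subseteq> P"
    using exists_prime_ideal_avoiding[OF V, of "principal V y" "{1}"] by auto
  \<comment> \<open>Since z = y (z x), every element of \<open>Q\<close> is a multiple of
    \<open>y\<close>.\<close>
  have "Q \<subseteq> P"
  proof
    fix z assume "z \<in> Q"
    then have "z * x ^ 1 \<in> V"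
      unfolding Q_def by blast
    moreover have "z = y * (z * x ^ 1)"
      using y(2) by (simp add: mult.left_commute mult.commute)
    ultimately show "z \<in> P"
      using P(2) unfolding principal_def by blast
  qed
  moreover have "y \<in> P"
    using P(2) subring_one[OF V] unfolding principal_def by force
  moreover have "y \<notin> Q"
  proof
    assume "y \<in> Q"
    then have "y * x ^ 2 \<in> V"
      unfolding Q_def by blast
    moreover have "y * x ^ 2 = x"
      using y(2) by (simp add: power2_eq_square mult.commute mult.left_commute)
    ultimately show False
      using x by simp
  qed
  moreover have "r * x ^ n \<in> V" for n
    using r(1) r(3)[of n] by (cases "n = 0") auto
  then have "Q \<noteq> {0}"
    using r(1,2) by (auto simp: Q_def)
  ultimately show False
    using krull_dim_oneD[OF V dim P(1) Q_prime] by blast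
qed

lemma Inter_rank_one_completely_integrally_closed:
  assumes "\<And>V. V \<in> \<V> \<Longrightarrow> is_rank_one_valuation_overring D V" "D = \<Inter>\<V>"
  shows "is_completely_integrally_closed D"
  unfolding is_completely_integrally_closed_def
proof (intro ballI impI, elim conjE)
  fix x r assume r: "r \<in> D" "r \<noteq> 0" "\<forall>n\<ge>1. r * x ^ n \<in> D"
  have "x \<in> V" if "V \<in> \<V>" for V
  proof (rule rank_one_valuation_completely_integrally_closed)
    show "is_subring V" "krull_dim V = 1" "\<And>z. z \<noteq> 0 \<Longrightarrow> z \<in> V \<or> inverse z \<in> V"
      using assms(1)[OF that]
      by (auto simp: is_rank_one_valuation_overring_def is_valuation_overring_def)
  qed (use r that assms(2) in auto)
  then show "x \<in> D"
    using assms(2) by blast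
qed

text \<open>With x = a / b and an integral equation of degree d, the single element
  \<open>b ^ d\<close> is a denominator of all powers of \<open>x\<close>: it clears x^n for n \<le>
  d, and the equation reduces higher powers to lower ones.\<close>

lemma integral_imp_almost_integral:
  assumes R: "is_subring R" and x: "x \<in> quotient_field R" "is_integral_over R x"
  shows "\<exists>r\<in>R. r \<noteq> 0 \<and> (\<forall>n. r * x ^ n \<in> R)"
proof -
  obtain p where p: "lead_coeff p = 1" "\<And>i. coeff p i \<in> R" "poly p x = 0"
    using x(2) by (auto simp: is_integral_over_def)
  obtain a b where ab: "x = a / b" "a \<in> R" "b \<in> R" "b \<noteq> 0"
    using x(1) by (auto simp: quotient_field_def)
  define d where "d = degree p"
  have "x ^ d = - (\<Sum>i<d. coeff p i * x ^ i)"
    using p(1,3) by (simp add: poly_altdef d_def lessThan_Suc_atMost[symmetric] eq_neg_iff_add_eq_0 add.commute)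
  then have step: "x ^ (d + k) = - (\<Sum>i<d. coeff p i * x ^ (i + k))" for k
    by (simp add: power_add sum_distrib_right mult.assoc)
  have "b ^ d * x ^ n \<in> R" for n
  proof (induction n rule: less_induct)
    case (less n)
    show ?case
    proof (cases "n \<le> d")
      case True
      then have "b ^ d * x ^ n = b ^ (d - n) * a ^ n"
        using ab(1,4) by (simp add: power_divide power_diff)
      then show ?thesis
        using R ab by (simp add: subring_mult subring_power)
    next
      case False
      define k where "k = n - d"
      have n: "n = d + k"
        using False by (simp add: k_def)
      have "b ^ d * x ^ n = - (\<Sum>i<d. coeff p i * (b ^ d * x ^ (i + k)))"
        unfolding n step by (simp add: sum_distrib_left mult.left_commute)
      also have "\<dots> \<in> R"
        using less n by (intro subring_uminus[OF R] subring_sum[OF R] subring_mult[OF R p(2)]) auto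
      finally show ?thesis .
    qed
  qed
  moreover have "b ^ d \<in> R" "b ^ d \<noteq> 0"
    using R ab subring_power by auto
  ultimately show ?thesis
    by blast
qed

lemma completely_integrally_closed_imp_integrally_closed:
  assumes "is_subring R" "is_completely_integrally_closed R"
  shows "is_integrally_closed R"
  using assms integral_imp_almost_integral
  unfolding is_integrally_closed_def is_completely_integrally_closed_def by metis

section \<open>Power series over \<open>D\<close>\<close>

lemma fps_to_fls_in_power_series_ring:
  "fps_to_fls f \<in> power_series_ring D \<longleftrightarrow> (\<forall>n. fps_nth f n \<in> D)"
  by (auto simp: power_series_ring_def)

lemma power_series_ring_subring:
  assumes "is_subring D"
  shows "is_subring (power_series_ring D)"
  unfolding is_subring_def
proof (intro conjI ballI)
  have "fps_to_fls 1 \<in> power_series_ring D"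
    unfolding fps_to_fls_in_power_series_ring using subring_one[OF assms] subring_zero[OF assms] by simp
  then show "1 \<in> power_series_ring D"
    by simp
next
  fix f g assume "f \<in> power_series_ring D" "g \<in> power_series_ring D"
  then obtain F G where FG: "f = fps_to_fls F" "g = fps_to_fls G" "\<And>n. fps_nth F n \<in> D" "\<And>n. fps_nth G n \<in> D"
    by (auto simp: power_series_ring_def)
  have "fps_to_fls (F - G) \<in> power_series_ring D" "fps_to_fls (F * G) \<in> power_series_ring D"
    unfolding fps_to_fls_in_power_series_ring using FG(3,4) assms
    by (auto simp: fps_mult_nth intro!: subring_sum subring_diff subring_mult)
  then show "f - g \<in> power_series_ring D" "f * g \<in> power_series_ring D"
    by (simp_all add: FG(1,2) fls_times_fps_to_fls)
qed

text \<open>The coefficients of \<open>f\<close> are treated one by one. Once those below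
  \<open>k\<close> lie in \<open>D\<close>, the truncation \<open>g\<close> may be subtracted. If
  the k-th coefficient c is nonzero, the lowest coefficient of r (f - g)^n is r_0 c^n, with r_0 the
  lowest coefficient of \<open>r\<close>; so c is almost integral over \<open>D\<close>.\<close>

lemma power_series_ring_completely_integrally_closed:
  assumes D: "is_subring D" and quot: "quotient_field D = UNIV"
    and cic: "is_completely_integrally_closed D"
  shows "is_completely_integrally_closed (power_series_ring D)"
  unfolding is_completely_integrally_closed_def
proof (intro ballI impI, elim conjE)
  fix f r assume r: "r \<in> power_series_ring D" "r \<noteq> 0" "\<forall>n\<ge>1. r * f ^ n \<in> power_series_ring D"
  note S = power_series_ring_subring[OF D]
  obtain R where R: "r = fps_to_fls R" "\<And>n. fps_nth R n \<in> D"
    using r(1) by (auto simp: power_series_ring_def)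
  have "fls_subdegree f \<ge> 0"
  proof (rule ccontr)
    assume neg: "\<not> ?thesis"
    then have "f \<noteq> 0"
      by auto
    \<comment> \<open>With this exponent a pole of \<open>f\<close> outweighs the order of vanishing
      of \<open>r\<close>, so that r f^n would have a pole.\<close>
    let ?n = "Suc (subdegree R)"
    have "fls_subdegree (r * f ^ ?n) = int (subdegree R) + int ?n * fls_subdegree f"
      using \<open>f \<noteq> 0\<close> r(2) R(1) by (simp add: fls_subdegree_pow fls_subdegree_fls_to_fps del: power_Suc)
    also have "int ?n * fls_subdegree f \<le> int ?n * (- 1)"
      using neg by (intro mult_left_mono) auto
    finally have "fls_subdegree (r * f ^ ?n) < 0"
      by simp
    moreover have "r * f ^ ?n \<in> power_series_ring D"
      using r(3) by (simp del: power_Suc)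
    ultimately show False
      by (auto simp: power_series_ring_def fls_subdegree_fls_to_fps simp del: power_Suc)
  qed
  then obtain F where F: "f = fps_to_fls F"
    by (metis fls_regpart_to_fls_trivial)
  have rf: "r * f ^ n \<in> power_series_ring D" for n
    using r(1,3) by (cases "n = 0") auto
  have "fps_nth F k \<in> D" for k
  proof (induction k rule: less_induct)
    case (less k)
    define G where "G = fps_cutoff k F"
    define g where "g = fps_to_fls G"
    have g: "g \<in> power_series_ring D"
      using less subring_zero[OF D] by (auto simp: G_def g_def fps_to_fls_in_power_series_ring)
    \<comment> \<open>Keeping \<open>i\<close> general allows the recursion f^i (f - g)^(n+1) =
      f^(i+1) (f - g)^n - g f^i (f - g)^n in place of a binomial expansion.\<close>
    have rfg: "r * f ^ i * (f - g) ^ n \<in> power_series_ring D" for i n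
    proof (induction n arbitrary: i)
      case (Suc n)
      have "r * f ^ i * (f - g) ^ Suc n = r * f ^ Suc i * (f - g) ^ n - g * (r * f ^ i * (f - g) ^ n)"
        by (simp add: algebra_simps)
      then show ?case
        using subring_diff[OF S Suc subring_mult[OF S g Suc]] by (simp only:)
    qed (use rf in auto)
    show ?case
    proof (cases "fps_nth F k = 0")
      case False
      then have sub: "subdegree (F - G) = k"
        by (intro subdegreeI) (auto simp: G_def)
      have "fps_nth R (subdegree R) * fps_nth F k ^ n \<in> D" for n
      proof -
        have "fps_nth (R * (F - G) ^ n) (subdegree R + subdegree ((F - G) ^ n)) \<in> D"
        proof -
          have "fps_to_fls (R * (F - G) ^ n) = r * f ^ 0 * (f - g) ^ n"
            by (simp add: F R(1) g_def fls_times_fps_to_fls fps_to_fls_power)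
          then have "fps_to_fls (R * (F - G) ^ n) \<in> power_series_ring D"
            using rfg[of 0 n] by (simp only:)
          then show ?thesis
            unfolding fps_to_fls_in_power_series_ring by blast
        qed
        moreover have "fps_nth (F - G) k = fps_nth F k"
          by (simp add: G_def)
        ultimately show ?thesis
          unfolding nth_subdegree_mult unfolding subdegree_power fps_pow_base unfolding sub by simp
      qed
      moreover have "fps_nth R (subdegree R) \<in> D" "fps_nth R (subdegree R) \<noteq> 0"
        using R r(2) by auto
      ultimately show ?thesis
        using cic quot unfolding is_completely_integrally_closed_def by blast
    qed (use subring_zero[OF D] in auto)
  qed
  then show "f \<in> power_series_ring D"
    unfolding F power_series_ring_def by auto
qed

text \<open>Constants embed \<open>K\<close> into K((X)) and meet D[[X]] exactly in
  \<open>D\<close>, so an integral equation over \<open>D\<close> can be read over D[[X]].\<close>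

lemma integrally_closed_of_power_series_ring:
  assumes D: "is_subring D" and ic: "is_integrally_closed (power_series_ring D)"
  shows "is_integrally_closed D"
  unfolding is_integrally_closed_def
proof (intro ballI impI)
  fix x assume x: "x \<in> quotient_field D" "is_integral_over D x"
  have const: "fls_const c \<in> power_series_ring D \<longleftrightarrow> c \<in> D" for c
  proof -
    have "fls_const c = fps_to_fls g \<longleftrightarrow> g = fps_const c" for g
      by (metis fps_const_to_fls fps_to_fls_eq_iff)
    then show ?thesis
      using subring_zero[OF D] by (auto simp: power_series_ring_def image_iff)
  qed
  obtain a b where ab: "x = a / b" "a \<in> D" "b \<in> D" "b \<noteq> 0"
    using x(1) by (auto simp: quotient_field_def)
  then have "fls_const x = fls_const a / fls_const b"
    by (simp add: fls_const_nonzero field_simps)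
  then have "fls_const x \<in> quotient_field (power_series_ring D)"
    using ab const fls_const_nonzero unfolding quotient_field_def by blast
  moreover obtain p where p: "lead_coeff p = 1" "\<And>i. coeff p i \<in> D" "poly p x = 0"
    using x(2) by (auto simp: is_integral_over_def)
  have "degree (map_poly fls_const p) = degree p"
    by (simp add: degree_map_poly fls_const_nonzero)
  moreover have "poly (map_poly fls_const p) (fls_const x) = fls_const (poly p x)"
    by (induction p) (simp_all add: map_poly_pCons fls_plus_const)
  ultimately have "is_integral_over (power_series_ring D) (fls_const x)"
    using p const unfolding is_integral_over_def
    by (intro exI[of _ "map_poly fls_const p"]) (simp add: coeff_map_poly)
  then show "x \<in> D"
    using ic const \<open>fls_const x \<in> quotient_field _\<close> by (auto simp: is_integrally_closed_def)
qed

text \<open>The convolution recursion is the coefficient form of C = 1 + X C^2, and it makes the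
  values natural numbers at sight, which lie in every subring.\<close>

fun catalan :: "nat \<Rightarrow> nat" where
  "catalan 0 = 1"
| "catalan (Suc n) = (\<Sum>i\<le>n. catalan i * catalan (n - i))"

text \<open>
  A failure of the Archimedean property, \<open>0 \<noteq> b \<in> \<Inter>\<^sub>n (a\<^sup>n)\<close>, makes the power series root
  \<open>Y = - \<Sum>\<^sub>n C\<^sub>n X\<^sup>n\<^sup>+\<^sup>1 / a\<^sup>2\<^sup>n\<^sup>+\<^sup>1\<close> of \<open>Y\<^sup>2 + a Y + X\<close>, with \<open>C\<^sub>n\<close> the Catalan numbers, a quotient
  of elements of \<open>D[[X]]\<close>; its first coefficient is \<open>- 1 / a\<close>.
\<close>

lemma archimedean_of_power_series_ring:
  assumes D: "is_subring D" and ic: "is_integrally_closed (power_series_ring D)"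
  shows "is_archimedean D"
  unfolding is_archimedean_def
proof (intro ballI impI equalityI subsetI)
  fix a b assume a: "a \<in> D" "\<not> is_unit_in D a" and b: "b \<in> (\<Inter>n\<in>{1..}. principal D (a ^ n))"
  show "b \<in> {0}"
  proof (rule ccontr)
    assume "b \<notin> {0}"
    then have "b \<noteq> 0" "a \<noteq> 0"
      using b by (auto simp: principal_def)
    have b_div: "b / a ^ n \<in> D" if "n \<ge> 1" for n
      using b that \<open>a \<noteq> 0\<close> by (auto simp: in_principal_iff)
    \<comment> \<open>The Catalan generating function at X / a^2, whence the functional equation
      below.\<close>
    define C where "C = Abs_fps (\<lambda>n. of_nat (catalan n) / a ^ (2 * n))"
    have C: "C = 1 + fps_const (1 / a ^ 2) * fps_X * C ^ 2"
    proof (rule fps_ext)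
      fix n show "fps_nth C n = fps_nth (1 + fps_const (1 / a ^ 2) * fps_X * C ^ 2) n"
      proof (cases n)
        case (Suc m)
        have "fps_nth (C ^ 2) m = (\<Sum>i\<le>m. of_nat (catalan i * catalan (m - i)) / a ^ (2 * m))"
          unfolding power2_eq_square fps_mult_nth atLeast0AtMost
          by (intro sum.cong) (auto simp: C_def simp flip: power_add distrib_left)
        also have "\<dots> = of_nat (catalan n) / a ^ (2 * m)"
          by (simp add: Suc sum_divide_distrib)
        finally show ?thesis
          by (simp add: C_def Suc mult.assoc power2_eq_square del: catalan.simps)
      qed (simp add: C_def)
    qed
    define Y where "Y = - (fps_const (1 / a) * fps_X * C)"
    have Y_nth: "fps_nth Y n = (case n of 0 \<Rightarrow> 0 | Suc m \<Rightarrow> - (of_nat (catalan m) / a ^ (2 * m + 1)))" for n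
      by (cases n) (auto simp: Y_def C_def mult.assoc)
    \<comment> \<open>With Y = - X C / a the three terms are X^2 C^2 / a^2, - X C and X, whose sum
      vanishes by the functional equation of \<open>C\<close>.\<close>
    have "Y ^ 2 + fps_const a * Y + fps_X
        = fps_X * ((1 + fps_const (1 / a ^ 2) * fps_X * C ^ 2) - C)"
      using \<open>a \<noteq> 0\<close> by (simp add: Y_def power2_eq_square algebra_simps flip: fps_const_mult)
        (simp add: mult.assoc[symmetric] flip: mult.assoc)
    then have root: "Y ^ 2 + fps_const a * Y + fps_X = 0"
      using C by simp
    let ?y = "fps_to_fls Y"
    note mem = fps_to_fls_in_power_series_ring
    \<comment> \<open>\<open>b\<close> is divisible by all positive powers of \<open>a\<close>,
      hence a common denominator of all coefficients of \<open>Y\<close>. This puts \<open>Y\<close>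
      into the quotient field of D[[X]].\<close>
    have "fps_nth (fps_const b * Y) n \<in> D" for n
    proof (cases n)
      case (Suc m)
      have "of_nat (catalan m) * (b / a ^ (2 * m + 1)) \<in> D"
        by (intro subring_mult[OF D subring_of_nat[OF D] b_div]) simp
      then show ?thesis
        using subring_uminus[OF D] by (simp add: Suc Y_nth mult.commute)
    qed (use subring_zero[OF D] Y_nth in auto)
    then have "fps_to_fls (fps_const b * Y) \<in> power_series_ring D"
      using mem by blast
    moreover have "b \<in> D"
      using b_div[of 1] subring_mult[OF D a(1), of "b / a"] \<open>a \<noteq> 0\<close> by simp
    then have "fls_const b \<in> power_series_ring D"
      using mem[of "fps_const b"] subring_zero[OF D] by simp
    moreover have "?y = fps_to_fls (fps_const b * Y) / fls_const b"
      using \<open>b \<noteq> 0\<close> by (simp add: fls_times_fps_to_fls fls_const_nonzero)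
    ultimately have "?y \<in> quotient_field (power_series_ring D)"
      using \<open>b \<noteq> 0\<close> fls_const_nonzero unfolding quotient_field_def by blast
    moreover have "is_integral_over (power_series_ring D) ?y"
      unfolding is_integral_over_def
    proof (intro exI conjI allI)
      let ?p = "[:fls_X, fls_const a, 1:]"
      show "lead_coeff ?p = 1"
        by simp
      have "fls_X \<in> power_series_ring D" "fls_const a \<in> power_series_ring D"
        using mem[of fps_X D] mem[of "fps_const a" D] a subring_zero[OF D] subring_one[OF D]
        by (simp_all add: fps_X_nth)
      then show "coeff ?p i \<in> power_series_ring D" for i
        using subring_one subring_zero power_series_ring_subring[OF D]
        by (auto simp: coeff_pCons split: nat.splits)
      have "fps_to_fls (Y ^ 2 + fps_const a * Y + fps_X) = 0"
        by (simp add: root)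
      then show "poly ?p ?y = 0"
        by (simp add: fls_times_fps_to_fls fps_to_fls_power algebra_simps power2_eq_square)
    qed
    ultimately have "?y \<in> power_series_ring D"
      using ic unfolding is_integrally_closed_def by blast
    then have "fps_nth Y 1 \<in> D"
      using mem by blast
    then have "1 / a \<in> D"
      using subring_uminus[OF D] by (fastforce simp: Y_nth)
    then show False
      using a \<open>a \<noteq> 0\<close> unfolding is_unit_in_def by auto
  qed
next
  fix a b :: 'a assume "b \<in> {0}"
  then show "b \<in> (\<Inter>n\<in>{1..}. principal D (a ^ n))"
    using subring_zero[OF D] by (force simp: principal_def)
qed

section \<open>The \<open>t\<close>-operation and the group of \<open>t\<close>-invertible \<open>t\<close>-ideals\<close>

locale domain_in_field =
  fixes D :: "'k::field set"
  assumes D: "is_subring D" and quot: "quotient_field D = UNIV"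
begin

lemma fractionE:
  obtains a b where "x = a / b" "a \<in> D" "b \<in> D" "b \<noteq> 0"
  using quot unfolding quotient_field_def by blast

lemma common_denominator:
  assumes "finite F"
  shows "\<exists>d\<in>D. d \<noteq> 0 \<and> (\<forall>x\<in>F. d * x \<in> D)"
  using assms
proof (induction F)
  case empty
  then show ?case
    using subring_one[OF D] by (intro bexI[of _ 1]) auto
next
  case (insert x F)
  then obtain d where d: "d \<in> D" "d \<noteq> 0" "\<forall>x\<in>F. d * x \<in> D"
    by blast
  obtain a b where ab: "x = a / b" "a \<in> D" "b \<in> D" "b \<noteq> 0"
    by (rule fractionE)
  have "b * d * y \<in> D" if "y \<in> F" for y
    using that d ab subring_mult[OF D, of b "d * y"] by (simp add: mult.assoc)
  moreover have "b * d * x = d * a"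
    using ab by simp
  ultimately show ?case
    using d ab subring_mult[OF D] by (intro bexI[of _ "b * d"]) auto
qed

lemma submodule_hull: "is_submodule D (is_submodule D hull S)"
  by (rule hull_in) (auto simp: is_submodule_def)

lemma submodule_D: "is_submodule D D"
  by (simp add: is_submodule_def subring_zero[OF D] subring_add[OF D] subring_mult[OF D])

text \<open>The double inverse in terms of multipliers \<open>y\<close>, for an arbitrary set
  \<open>F\<close>. With x = 1 it is the notion of coprimality used below.\<close>

lemma mem_v_closure: "x \<in> v_closure D F \<longleftrightarrow> (\<forall>y. (\<forall>f\<in>F. y * f \<in> D) \<longrightarrow> y * x \<in> D)"
  by (simp add: v_closure_def ideal_inverse_def mult.commute[of x])

lemma v_closure_mono: "F \<subseteq> G \<Longrightarrow> v_closure D F \<subseteq> v_closure D G"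
  unfolding mem_v_closure subset_iff by blast

lemma subset_v_closure: "F \<subseteq> v_closure D F"
  by (auto simp: mem_v_closure)

lemma v_closure_least: "F \<subseteq> v_closure D G \<Longrightarrow> v_closure D F \<subseteq> v_closure D G"
  by (auto simp: mem_v_closure subset_iff)

lemma ideal_inverse_submodule: "is_submodule D (ideal_inverse D F)"
  using D by (auto simp: is_submodule_def ideal_inverse_def distrib_right mult.assoc
      subring_zero subring_add subring_mult)

lemma v_closure_submodule: "is_submodule D (v_closure D F)"
  unfolding v_closure_def by (rule ideal_inverse_submodule)

lemma v_closure_hull: "v_closure D (is_submodule D hull F) = v_closure D F"
proof
  show "v_closure D (is_submodule D hull F) \<subseteq> v_closure D F"
    by (intro v_closure_least hull_minimal subset_v_closure v_closure_submodule)
qed (intro v_closure_mono hull_subset)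

text \<open>A finite set not contained in {0} takes the place of a nonzero finitely generated
  fractional ideal: passing to the span does not change the \<open>v\<close>-closure, and a common
  denominator makes the span fractional.\<close>

lemma mem_t_closure:
  assumes I: "is_submodule D I"
  shows "x \<in> t_closure D I \<longleftrightarrow> (\<exists>F. finite F \<and> F \<subseteq> I \<and> \<not> F \<subseteq> {0} \<and> x \<in> v_closure D F)"
proof
  assume "x \<in> t_closure D I"
  then obtain S where S: "finite S" "is_submodule D hull S \<subseteq> I"
    "is_submodule D hull S \<noteq> {0}" "x \<in> v_closure D (is_submodule D hull S)"
    unfolding t_closure_def is_finitely_generated_def is_nonzero_frac_ideal_def by blast
  moreover have "S \<subseteq> is_submodule D hull S"
    by (rule hull_subset)
  moreover have "is_submodule D {0}"
    by (simp add: is_submodule_def)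
  then have "is_submodule D hull S \<subseteq> {0}" if "S \<subseteq> {0}"
    using that by (intro hull_minimal)
  then have "\<not> S \<subseteq> {0}"
    using S(3) submodule_zero[OF submodule_hull, of S] by blast
  ultimately show "\<exists>F. finite F \<and> F \<subseteq> I \<and> \<not> F \<subseteq> {0} \<and> x \<in> v_closure D F"
    unfolding v_closure_hull by blast
next
  assume "\<exists>F. finite F \<and> F \<subseteq> I \<and> \<not> F \<subseteq> {0} \<and> x \<in> v_closure D F"
  then obtain F where F: "finite F" "F \<subseteq> I" "\<not> F \<subseteq> {0}" "x \<in> v_closure D F"
    by blast
  let ?J = "is_submodule D hull F"
  obtain d where d: "d \<in> D" "d \<noteq> 0" "\<forall>x\<in>F. d * x \<in> D"
    using common_denominator[OF F(1)] by blast
  have "is_submodule D {x. d * x \<in> D}"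
    using D by (auto simp: is_submodule_def distrib_left mult.left_commute
        subring_zero subring_add subring_mult)
  then have "?J \<subseteq> {x. d * x \<in> D}"
    using d by (intro hull_minimal) auto
  then have "is_fractional_ideal D ?J"
    unfolding is_fractional_ideal_def using submodule_hull d by blast
  moreover have "?J \<noteq> {0}"
    using F(3) hull_subset[of F "is_submodule D"] by auto
  moreover have "?J \<subseteq> I"
    using F(2) I by (rule hull_minimal)
  moreover have "is_finitely_generated D ?J"
    using F(1) unfolding is_finitely_generated_def by blast
  ultimately have "v_closure D ?J \<subseteq> t_closure D I"
    unfolding t_closure_def is_nonzero_frac_ideal_def by (intro Union_upper CollectI exI conjI) (rule refl)
  then show "x \<in> t_closure D I"
    using F(4) by (auto simp: v_closure_hull)
qed

lemma t_closure_mono: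
  assumes "is_submodule D I" "is_submodule D J" "I \<subseteq> J"
  shows "t_closure D I \<subseteq> t_closure D J"
proof
  fix x assume "x \<in> t_closure D I"
  then obtain F where "finite F" "F \<subseteq> I" "\<not> F \<subseteq> {0}" "x \<in> v_closure D F"
    unfolding mem_t_closure[OF assms(1)] by blast
  then show "x \<in> t_closure D J"
    unfolding mem_t_closure[OF assms(2)] using assms(3) by (intro exI[of _ F]) auto
qed

lemma subset_t_closure:
  assumes I: "is_submodule D I" "I \<noteq> {0}"
  shows "I \<subseteq> t_closure D I"
proof
  fix x assume x: "x \<in> I"
  obtain y where y: "y \<in> I" "y \<noteq> 0"
    using I submodule_zero[OF I(1)] by blast
  have "{x, y} \<subseteq> I" "\<not> {x, y} \<subseteq> {0}" "x \<in> v_closure D {x, y}"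
    using x y subset_v_closure[of "{x, y}"] by auto
  then show "x \<in> t_closure D I"
    unfolding mem_t_closure[OF I(1)] by (intro exI[of _ "{x, y}"]) auto
qed

lemma t_closure_submodule:
  assumes I: "is_submodule D I" "I \<noteq> {0}"
  shows "is_submodule D (t_closure D I)"
  unfolding is_submodule_def
proof (intro conjI ballI)
  show "0 \<in> t_closure D I"
    using subset_t_closure[OF I] submodule_zero[OF I(1)] by blast
next
  fix x y assume "x \<in> t_closure D I" "y \<in> t_closure D I"
  then obtain F G where FG: "finite F" "F \<subseteq> I" "\<not> F \<subseteq> {0}" "x \<in> v_closure D F"
    "finite G" "G \<subseteq> I" "y \<in> v_closure D G"
    unfolding mem_t_closure[OF I(1)] by blast
  then have "x \<in> v_closure D (F \<union> G)" "y \<in> v_closure D (F \<union> G)"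
    using v_closure_mono by (meson Un_upper1 Un_upper2 subsetD)+
  then have "x + y \<in> v_closure D (F \<union> G)"
    by (rule submodule_add[OF v_closure_submodule])
  moreover have "finite (F \<union> G)" "F \<union> G \<subseteq> I" "\<not> F \<union> G \<subseteq> {0}"
    using FG by auto
  ultimately show "x + y \<in> t_closure D I"
    unfolding mem_t_closure[OF I(1)] by blast
next
  fix r x assume "r \<in> D" "x \<in> t_closure D I"
  then show "r * x \<in> t_closure D I"
    unfolding mem_t_closure[OF I(1)] using submodule_mult[OF v_closure_submodule] by blast
qed

text \<open>The targets of inclusions of \<open>t\<close>-products, which then need checking on
  products of elements only. Inclusion instead of equality admits {0}, whose
  \<open>t\<close>-closure is empty; so inverses and residuals qualify without being nonzero or
  fractional.\<close>

definition t_closed :: "'k set \<Rightarrow> bool" where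
  "t_closed M \<longleftrightarrow> is_submodule D M \<and> t_closure D M \<subseteq> M"

lemma t_closedI:
  assumes "is_submodule D M"
    and "\<And>F x. finite F \<Longrightarrow> F \<subseteq> M \<Longrightarrow> \<not> F \<subseteq> {0} \<Longrightarrow> x \<in> v_closure D F \<Longrightarrow> x \<in> M"
  shows "t_closed M"
  unfolding t_closed_def
proof (intro conjI subsetI)
  fix x assume "x \<in> t_closure D M"
  then show "x \<in> M"
    using assms(2) unfolding mem_t_closure[OF assms(1)] by metis
qed (rule assms(1))

lemma t_closedD:
  assumes "t_closed M" "finite F" "F \<subseteq> M" "\<not> F \<subseteq> {0}"
  shows "v_closure D F \<subseteq> M"
proof
  fix x assume "x \<in> v_closure D F"
  then have "x \<in> t_closure D M"
    using assms mem_t_closure[of M x] unfolding t_closed_def by metis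
  then show "x \<in> M"
    using assms(1) by (auto simp: t_closed_def)
qed

lemma t_closed_submodule: "t_closed M \<Longrightarrow> is_submodule D M"
  by (simp add: t_closed_def)

lemma t_closure_least:
  assumes "is_submodule D I" "I \<subseteq> M" "t_closed M"
  shows "t_closure D I \<subseteq> M"
  using t_closure_mono[OF assms(1) t_closed_submodule[OF assms(3)] assms(2)] assms(3)
  by (auto simp: t_closed_def)

lemma t_closed_v_closure: "t_closed (v_closure D F)"
proof (intro t_closedI v_closure_submodule)
  fix G x assume "G \<subseteq> v_closure D F" "x \<in> v_closure D G"
  then show "x \<in> v_closure D F"
    using v_closure_least[of G F] by blast
qed

text \<open>Taking the inverse three times is the same as taking it once, so an inverse is its own
  \<open>v\<close>-closure.\<close>

lemma t_closed_ideal_inverse: "t_closed (ideal_inverse D F)"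
proof -
  have "ideal_inverse D F = v_closure D (ideal_inverse D F)"
  proof
    show "ideal_inverse D F \<subseteq> v_closure D (ideal_inverse D F)"
      by (rule subset_v_closure)
    show "v_closure D (ideal_inverse D F) \<subseteq> ideal_inverse D F"
    proof
      fix x assume "x \<in> v_closure D (ideal_inverse D F)"
      moreover have "\<forall>f\<in>ideal_inverse D F. y * f \<in> D" if "y \<in> F" for y
        using that by (auto simp: ideal_inverse_def mult.commute)
      ultimately have "y * x \<in> D" if "y \<in> F" for y
        using that unfolding mem_v_closure by blast
      then show "x \<in> ideal_inverse D F"
        by (simp add: ideal_inverse_def mult.commute)
    qed
  qed
  then show ?thesis
    using t_closed_v_closure by metis
qed

text \<open>Multiplication by \<open>c\<close> maps the \<open>v\<close>-closure of \<open>F\<close>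
  into that of c F. This replaces bilinearity: a claim x c \<in> M for all \<open>x\<close> in a
  \<open>t\<close>-closure follows from the claim on generators.\<close>

lemma t_closed_residual:
  assumes "t_closed M"
  shows "t_closed {x. x * c \<in> M}"
proof (rule t_closedI)
  note M = t_closed_submodule[OF assms]
  show "is_submodule D {x. x * c \<in> M}"
    using M by (auto simp: is_submodule_def distrib_right mult.assoc)
  fix F x assume F: "finite F" "F \<subseteq> {x. x * c \<in> M}" "\<not> F \<subseteq> {0}" "x \<in> v_closure D F"
  show "x \<in> {x. x * c \<in> M}"
  proof (cases "c = 0")
    case False
    let ?G = "(\<lambda>f. f * c) ` F"
    have "x * c \<in> v_closure D ?G"
      unfolding mem_v_closure
    proof (intro allI impI)
      fix y assume "\<forall>g\<in>?G. y * g \<in> D"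
      then have "\<forall>f\<in>F. (y * c) * f \<in> D"
        by (simp add: mult.assoc mult.commute[of c])
      then have "(y * c) * x \<in> D"
        using F(4) unfolding mem_v_closure by blast
      then show "y * (x * c) \<in> D"
        by (simp add: ac_simps)
    qed
    moreover have "finite ?G" "?G \<subseteq> M" "\<not> ?G \<subseteq> {0}"
      using F(1-3) False by auto
    ultimately show ?thesis
      using t_closedD[OF assms] by blast
  qed (use submodule_zero[OF M] in auto)
qed

lemma principal_eq: "c \<noteq> 0 \<Longrightarrow> principal D c = {x. x * (1 / c) \<in> D}"
  using in_principal_iff[of c _ D] by auto

lemma t_closed_D: "t_closed D"
proof -
  have "v_closure D {1} \<subseteq> D"
  proof
    fix x assume "x \<in> v_closure D {1}"
    then show "x \<in> D"
      using subring_one[OF D] unfolding mem_v_closure by (metis mult_1_left singletonD)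
  qed
  moreover have "D \<subseteq> v_closure D {1}"
    using D by (auto simp: mem_v_closure subring_mult)
  ultimately show ?thesis
    using t_closed_v_closure[of "{1}"] by (metis subset_antisym)
qed

lemma t_closed_principal: "c \<noteq> 0 \<Longrightarrow> t_closed (principal D c)"
  using t_closed_residual[OF t_closed_D, of "1 / c"] by (simp add: principal_eq)

text \<open>Finitely many elements of the \<open>t\<close>-closure are each witnessed by a finite
  subset of \<open>I\<close>, and the union of the witnesses serves them all.\<close>

lemma t_closed_t_closure:
  assumes "is_submodule D I" "I \<noteq> {0}"
  shows "t_closed (t_closure D I)"
proof (intro t_closedI t_closure_submodule assms)
  fix F x assume F: "finite F" "F \<subseteq> t_closure D I" "\<not> F \<subseteq> {0}" "x \<in> v_closure D F"
  have "\<forall>f\<in>F. \<exists>G. finite G \<and> G \<subseteq> I \<and> \<not> G \<subseteq> {0} \<and> f \<in> v_closure D G"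
    using F(2) mem_t_closure[OF assms(1)] by blast
  then obtain G where G: "\<And>f. f \<in> F \<Longrightarrow> finite (G f) \<and> G f \<subseteq> I \<and> \<not> G f \<subseteq> {0} \<and> f \<in> v_closure D (G f)"
    by metis
  have "F \<subseteq> v_closure D (\<Union>(G ` F))"
    using G v_closure_mono[of "G _" "\<Union>(G ` F)"] by blast
  then have "x \<in> v_closure D (\<Union>(G ` F))"
    using F(4) v_closure_least by blast
  moreover have "finite (\<Union>(G ` F))" "\<Union>(G ` F) \<subseteq> I"
    using F(1) G by auto
  moreover have "\<not> \<Union>(G ` F) \<subseteq> {0}"
    using F(3) G by fast
  ultimately show "x \<in> t_closure D I"
    unfolding mem_t_closure[OF assms(1)] by blast
qed

section \<open>Products of fractional ideals and their \<open>t\<close>-closures\<close>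

lemma ideal_mult_submodule: "is_submodule D (ideal_mult D I J)"
  unfolding ideal_mult_def by (rule submodule_hull)

lemma ideal_mult_mem: "a \<in> I \<Longrightarrow> b \<in> J \<Longrightarrow> a * b \<in> ideal_mult D I J"
  unfolding ideal_mult_def by (rule hull_inc) blast

lemma ideal_mult_least:
  "is_submodule D M \<Longrightarrow> (\<And>a b. a \<in> I \<Longrightarrow> b \<in> J \<Longrightarrow> a * b \<in> M) \<Longrightarrow> ideal_mult D I J \<subseteq> M"
  unfolding ideal_mult_def by (rule hull_minimal) auto

lemma ideal_mult_commute: "ideal_mult D I J = ideal_mult D J I"
  unfolding ideal_mult_def by (metis (no_types, opaque_lifting) mult.commute)

lemma nonzero_frac_idealD:
  assumes "is_nonzero_frac_ideal D I"
  shows "is_submodule D I" "I \<noteq> {0}" "\<exists>x\<in>I. x \<noteq> 0"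
proof -
  show "is_submodule D I" "I \<noteq> {0}"
    using assms by (auto simp: is_nonzero_frac_ideal_def is_fractional_ideal_def)
  then show "\<exists>x\<in>I. x \<noteq> 0"
    using submodule_zero by blast
qed

text \<open>The denominator \<open>d\<close> may be any nonzero element of the field, since its
  numerator does the job as well.\<close>

lemma nonzero_frac_idealI:
  assumes "is_submodule D I" "x \<in> I" "x \<noteq> 0" "d \<noteq> 0" "\<And>x. x \<in> I \<Longrightarrow> d * x \<in> D"
  shows "is_nonzero_frac_ideal D I"
proof -
  obtain a b where ab: "d = a / b" "a \<in> D" "b \<in> D" "b \<noteq> 0"
    by (rule fractionE)
  have "a * x \<in> D" if "x \<in> I" for x
    using ab subring_mult[OF D ab(3) assms(5)[OF that]] by simp
  then show ?thesis
    using assms ab unfolding is_nonzero_frac_ideal_def is_fractional_ideal_def by auto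
qed

lemma nonzero_frac_ideal_t_closure:
  assumes "is_nonzero_frac_ideal D I"
  shows "is_nonzero_frac_ideal D (t_closure D I)"
proof -
  note I = nonzero_frac_idealD[OF assms]
  obtain d where d: "d \<in> D" "d \<noteq> 0" "\<And>x. x \<in> I \<Longrightarrow> d * x \<in> D"
    using assms by (auto simp: is_nonzero_frac_ideal_def is_fractional_ideal_def)
  obtain x where x: "x \<in> I" "x \<noteq> 0"
    using I(3) by blast
  have "t_closure D I \<subseteq> {x. x * d \<in> D}"
    using d(3) by (intro t_closure_least t_closed_residual t_closed_D I(1)) (auto simp: mult.commute)
  moreover have "x \<in> t_closure D I"
    using subset_t_closure[OF I(1,2)] x(1) by blast
  ultimately show ?thesis
    using x(2) d(2) t_closure_submodule[OF I(1,2)]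
    by (intro nonzero_frac_idealI[of _ x d]) (auto simp: mult.commute)
qed

lemma nonzero_frac_ideal_mult:
  assumes "is_nonzero_frac_ideal D I" "is_nonzero_frac_ideal D J"
  shows "is_nonzero_frac_ideal D (ideal_mult D I J)"
proof -
  obtain d where d: "d \<in> D" "d \<noteq> 0" "\<And>x. x \<in> I \<Longrightarrow> d * x \<in> D"
    using assms by (auto simp: is_nonzero_frac_ideal_def is_fractional_ideal_def)
  obtain e where e: "e \<in> D" "e \<noteq> 0" "\<And>x. x \<in> J \<Longrightarrow> e * x \<in> D"
    using assms by (auto simp: is_nonzero_frac_ideal_def is_fractional_ideal_def)
  obtain x y where xy: "x \<in> I" "x \<noteq> 0" "y \<in> J" "y \<noteq> 0"
    using nonzero_frac_idealD(3)[OF assms(1)] nonzero_frac_idealD(3)[OF assms(2)] by blast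
  have "ideal_mult D I J \<subseteq> {x. x * (d * e) \<in> D}"
  proof (rule ideal_mult_least)
    fix a b assume "a \<in> I" "b \<in> J"
    then have "(d * a) * (e * b) \<in> D"
      by (intro subring_mult[OF D d(3) e(3)])
    then show "a * b \<in> {x. x * (d * e) \<in> D}"
      by (simp add: ac_simps)
  qed (rule t_closed_submodule[OF t_closed_residual[OF t_closed_D]])
  then show ?thesis
    using d(2) e(2) xy(2,4) ideal_mult_mem[OF xy(1,3)] ideal_mult_submodule
    by (intro nonzero_frac_idealI[of _ "x * y" "d * e"]) (auto simp: mult.commute[of "d * e"])
qed

lemma nonzero_frac_ideal_inverse:
  assumes "is_nonzero_frac_ideal D I"
  shows "is_nonzero_frac_ideal D (ideal_inverse D I)"
proof -
  obtain d where d: "d \<in> D" "d \<noteq> 0" "\<And>x. x \<in> I \<Longrightarrow> d * x \<in> D"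
    using assms by (auto simp: is_nonzero_frac_ideal_def is_fractional_ideal_def)
  obtain y where y: "y \<in> I" "y \<noteq> 0"
    using nonzero_frac_idealD(3)[OF assms] by blast
  show ?thesis
  proof (rule nonzero_frac_idealI[OF ideal_inverse_submodule _ d(2) y(2)])
    show "d \<in> ideal_inverse D I"
      using d(3) by (simp add: ideal_inverse_def)
    show "y * x \<in> D" if "x \<in> ideal_inverse D I" for x
    proof -
      have "x * y \<in> D"
        using that y(1) by (simp add: ideal_inverse_def)
      then show ?thesis
        by (simp add: mult.commute)
    qed
  qed
qed

abbreviation t_mult :: "'k set \<Rightarrow> 'k set \<Rightarrow> 'k set" where
  "t_mult I J \<equiv> t_closure D (ideal_mult D I J)"

lemma t_mult_least:
  assumes "t_closed M" "\<And>a b. a \<in> I \<Longrightarrow> b \<in> J \<Longrightarrow> a * b \<in> M"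
  shows "t_mult I J \<subseteq> M"
  using assms by (intro t_closure_least ideal_mult_submodule ideal_mult_least t_closed_submodule)

lemma t_mult_mem:
  assumes "is_nonzero_frac_ideal D I" "is_nonzero_frac_ideal D J" "a \<in> I" "b \<in> J"
  shows "a * b \<in> t_mult I J"
  using subset_t_closure[OF nonzero_frac_idealD(1,2)[OF nonzero_frac_ideal_mult[OF assms(1,2)]]]
    ideal_mult_mem[OF assms(3,4)] by blast

lemma t_closed_t_mult:
  assumes "is_nonzero_frac_ideal D I" "is_nonzero_frac_ideal D J"
  shows "t_closed (t_mult I J)"
  using nonzero_frac_idealD(1,2)[OF nonzero_frac_ideal_mult[OF assms]] by (rule t_closed_t_closure)

lemma nonzero_frac_ideal_t_mult:
  assumes "is_nonzero_frac_ideal D I" "is_nonzero_frac_ideal D J"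
  shows "is_nonzero_frac_ideal D (t_mult I J)"
  using assms by (intro nonzero_frac_ideal_t_closure nonzero_frac_ideal_mult)

lemma t_mult_commute: "t_mult I J = t_mult J I"
  by (simp add: ideal_mult_commute)

text \<open>One factor is treated at a time: for fixed c \<in> K the residual of the right-hand side
  by \<open>c\<close> is \<open>t\<close>-closed, so it is enough to look at products a b. The
  opposite inclusion is the same one for \<open>K\<close>, \<open>J\<close>, \<open>I\<close> after
  commuting.\<close>

lemma t_mult_assoc_subset:
  assumes I: "is_nonzero_frac_ideal D I" and J: "is_nonzero_frac_ideal D J"
    and K: "is_nonzero_frac_ideal D K"
  shows "t_mult (t_mult I J) K \<subseteq> t_mult I (t_mult J K)"
proof -
  let ?M = "t_mult I (t_mult J K)"
  have M: "t_closed ?M"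
    by (rule t_closed_t_mult[OF I nonzero_frac_ideal_t_mult[OF J K]])
  show ?thesis
  proof (rule t_mult_least[OF M])
    fix x c assume x: "x \<in> t_mult I J" and c: "c \<in> K"
    have "t_mult I J \<subseteq> {x. x * c \<in> ?M}"
    proof (intro t_mult_least t_closed_residual M)
      fix a b assume "a \<in> I" "b \<in> J"
      then have "a * (b * c) \<in> ?M"
        using c by (intro t_mult_mem[OF I nonzero_frac_ideal_t_mult[OF J K]] t_mult_mem[OF J K])
      then show "a * b \<in> {x. x * c \<in> ?M}"
        by (simp add: mult.assoc)
    qed
    then show "x * c \<in> ?M"
      using x by blast
  qed
qed

lemma t_mult_assoc:
  assumes "is_nonzero_frac_ideal D I" "is_nonzero_frac_ideal D J" "is_nonzero_frac_ideal D K"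
  shows "t_mult (t_mult I J) K = t_mult I (t_mult J K)"
  using t_mult_assoc_subset[OF assms] t_mult_assoc_subset[OF assms(3,2,1)]
  by (simp add: t_mult_commute[of K] t_mult_commute[of _ I] t_mult_commute[of J I])

lemma is_t_ideal_iff: "is_t_ideal D I \<longleftrightarrow> is_nonzero_frac_ideal D I \<and> t_closed I"
  unfolding is_t_ideal_def t_closed_def
  using nonzero_frac_idealD subset_t_closure by blast

lemma nonzero_frac_ideal_D: "is_nonzero_frac_ideal D D"
  using subring_one[OF D] by (intro nonzero_frac_idealI[of _ 1 1] submodule_D) auto

lemma t_ideal_D: "is_t_ideal D D"
  by (simp add: is_t_ideal_iff nonzero_frac_ideal_D t_closed_D)

lemma t_mult_one:
  assumes "is_t_ideal D I"
  shows "t_mult D I = I"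
proof
  have I: "is_nonzero_frac_ideal D I" "t_closed I"
    using assms by (auto simp: is_t_ideal_iff)
  show "t_mult D I \<subseteq> I"
    using I(2) submodule_mult[OF t_closed_submodule[OF I(2)]] by (rule t_mult_least)
  show "I \<subseteq> t_mult D I"
    using t_mult_mem[OF nonzero_frac_ideal_D I(1) subring_one[OF D]] by auto
qed

lemma t_mult_inverse_subset: "t_mult I (ideal_inverse D I) \<subseteq> D"
  by (intro t_mult_least t_closed_D) (auto simp: ideal_inverse_def mult.commute)

text \<open>The inverse contains \<open>J\<close>, so its \<open>t\<close>-product with
  \<open>I\<close> contains 1 as well, and that product never leaves \<open>D\<close>. Thus any
  convenient candidate \<open>J\<close> for the inverse will do.\<close>

lemma t_invertibleI:
  assumes I: "is_nonzero_frac_ideal D I" and J: "J \<subseteq> ideal_inverse D I" "is_nonzero_frac_ideal D J"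
    and one: "1 \<in> t_mult I J"
  shows "is_t_invertible D I"
proof -
  note J' = nonzero_frac_ideal_inverse[OF I]
  have "t_mult I J \<subseteq> t_mult I (ideal_inverse D I)"
    using I J J' by (intro t_mult_least t_closed_t_mult) (blast intro: t_mult_mem)+
  then have "1 \<in> t_mult I (ideal_inverse D I)"
    using one by blast
  then have "D \<subseteq> t_mult I (ideal_inverse D I)"
    using submodule_mult[OF t_closed_submodule[OF t_closed_t_mult[OF I J']]] by fastforce
  then show ?thesis
    using I t_mult_inverse_subset unfolding is_t_invertible_def by blast
qed

section \<open>The group of \<open>t\<close>-invertible \<open>t\<close>-ideals and the
  \<open>t\<close>-class group\<close>

definition invertible_t_ideals :: "'k set set" where
  "invertible_t_ideals = {I. is_t_ideal D I \<and> is_t_invertible D I}"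

lemma invertible_t_idealD:
  assumes "I \<in> invertible_t_ideals"
  shows "is_nonzero_frac_ideal D I" "t_closed I" "t_mult I (ideal_inverse D I) = D" "is_t_ideal D I"
  using assms by (auto simp: invertible_t_ideals_def is_t_ideal_iff is_t_invertible_def)

text \<open>The candidate for the inverse is the \<open>t\<close>-product of the two inverses;
  regrouping the four factors gives the \<open>t\<close>-product of \<open>D\<close> with
  \<open>D\<close>.\<close>

lemma t_mult_invertible:
  assumes "I \<in> invertible_t_ideals" "J \<in> invertible_t_ideals"
  shows "t_mult I J \<in> invertible_t_ideals"
proof -
  note I = invertible_t_idealD[OF assms(1)] and J = invertible_t_idealD[OF assms(2)]
  let ?I' = "ideal_inverse D I" and ?J' = "ideal_inverse D J"
  note I' = nonzero_frac_ideal_inverse[OF I(1)] and J' = nonzero_frac_ideal_inverse[OF J(1)]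
  note IJ = nonzero_frac_ideal_t_mult[OF I(1) J(1)] and IJ' = nonzero_frac_ideal_t_mult[OF I' J']
  have "is_t_invertible D (t_mult I J)"
  proof (rule t_invertibleI[OF IJ _ IJ'])
    show "t_mult ?I' ?J' \<subseteq> ideal_inverse D (t_mult I J)"
    proof (intro t_mult_least t_closed_ideal_inverse)
      fix x y assume x: "x \<in> ?I'" and y: "y \<in> ?J'"
      have "t_mult I J \<subseteq> {z. z * (x * y) \<in> D}"
      proof (intro t_mult_least t_closed_residual t_closed_D)
        fix a b assume "a \<in> I" "b \<in> J"
        then have "x * a \<in> D" "y * b \<in> D"
          using x y by (auto simp: ideal_inverse_def)
        then have "(x * a) * (y * b) \<in> D"
          by (rule subring_mult[OF D])
        then show "a * b \<in> {z. z * (x * y) \<in> D}"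
          by (simp add: ac_simps)
      qed
      then show "x * y \<in> ideal_inverse D (t_mult I J)"
        by (auto simp: ideal_inverse_def mult.commute)
    qed
    have "t_mult J (t_mult ?I' ?J') = t_mult ?I' (t_mult J ?J')"
      using t_mult_assoc[OF J(1) I' J'] t_mult_assoc[OF I' J(1) J'] by (simp add: t_mult_commute[of J])
    then have "t_mult (t_mult I J) (t_mult ?I' ?J') = t_mult (t_mult I ?I') (t_mult J ?J')"
      using t_mult_assoc[OF I(1) J(1) IJ'] t_mult_assoc[OF I(1) I' nonzero_frac_ideal_t_mult[OF J(1) J']]
      by simp
    then show "1 \<in> t_mult (t_mult I J) (t_mult ?I' ?J')"
      using t_mult_one[OF t_ideal_D] subring_one[OF D] I(3) J(3) by simp
  qed
  then show ?thesis
    using IJ t_closed_t_mult[OF I(1) J(1)] by (simp add: invertible_t_ideals_def is_t_ideal_iff)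
qed

lemma inverse_invertible:
  assumes "I \<in> invertible_t_ideals"
  shows "ideal_inverse D I \<in> invertible_t_ideals"
proof -
  note I = invertible_t_idealD[OF assms]
  note I' = nonzero_frac_ideal_inverse[OF I(1)]
  have "is_t_invertible D (ideal_inverse D I)"
    using I(3) subring_one[OF D]
    by (intro t_invertibleI[OF I' _ I(1)]) (auto simp: ideal_inverse_def t_mult_commute mult.commute)
  then show ?thesis
    using I' t_closed_ideal_inverse by (simp add: invertible_t_ideals_def is_t_ideal_iff)
qed

lemma principal_invertible:
  assumes "c \<noteq> 0"
  shows "principal D c \<in> invertible_t_ideals"
proof -
  have frac: "is_nonzero_frac_ideal D (principal D c)" if "c \<noteq> 0" for c
    using that t_closed_submodule[OF t_closed_principal[OF that]] subring_one[OF D]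
    by (intro nonzero_frac_idealI[of _ c "1 / c"]) (auto simp: in_principal_iff)
  have "is_t_invertible D (principal D c)"
  proof (rule t_invertibleI)
    show "principal D (1 / c) \<subseteq> ideal_inverse D (principal D c)"
      using assms D by (auto simp: principal_def ideal_inverse_def subring_mult)
    have "c * (1 / c) \<in> t_mult (principal D c) (principal D (1 / c))"
      using assms subring_one[OF D] by (intro t_mult_mem frac) (auto simp: in_principal_iff)
    then show "1 \<in> t_mult (principal D c) (principal D (1 / c))"
      using assms by simp
  qed (use frac assms in auto)
  then show ?thesis
    using frac assms t_closed_principal by (simp add: invertible_t_ideals_def is_t_ideal_iff)
qed

lemma t_mult_principal:
  assumes "c \<noteq> 0" "d \<noteq> 0"
  shows "t_mult (principal D c) (principal D d) = principal D (c * d)"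
proof
  show "t_mult (principal D c) (principal D d) \<subseteq> principal D (c * d)"
  proof (intro t_mult_least t_closed_principal)
    fix a b assume "a \<in> principal D c" "b \<in> principal D d"
    then have "(a / c) * (b / d) \<in> D"
      using assms by (intro subring_mult[OF D]) (simp_all add: in_principal_iff)
    then show "a * b \<in> principal D (c * d)"
      using assms by (simp add: in_principal_iff)
  qed (use assms in auto)
  show "principal D (c * d) \<subseteq> t_mult (principal D c) (principal D d)"
  proof
    fix x assume "x \<in> principal D (c * d)"
    then obtain r where "x = c * d * r" "r \<in> D"
      by (auto simp: principal_def)
    then have "x = c * (d * r)" "d * r \<in> principal D d"
      by (auto simp: principal_def mult.assoc)
    moreover have "c \<in> principal D c"
      using assms subring_one[OF D] by (simp add: in_principal_iff)
    ultimately show "x \<in> t_mult (principal D c) (principal D d)"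
      using principal_invertible assms by (metis t_mult_mem invertible_t_idealD(1))
  qed
qed

lemma principal_one: "principal D 1 = D"
  by (auto simp: principal_def)

lemma t_ideal_group_simps [simp]:
  "carrier (t_ideal_group D) = invertible_t_ideals"
  "monoid.mult (t_ideal_group D) = t_mult"
  "one (t_ideal_group D) = D"
  by (simp_all add: t_ideal_group_def invertible_t_ideals_def)

lemma t_ideal_comm_group: "comm_group (t_ideal_group D)"
proof (rule comm_groupI, simp_all only: t_ideal_group_simps)
  show "D \<in> invertible_t_ideals"
    using principal_invertible[of 1] by (simp add: principal_one)
  fix I J assume I: "I \<in> invertible_t_ideals" and J: "J \<in> invertible_t_ideals"
  show "t_mult I J \<in> invertible_t_ideals"
    using I J by (rule t_mult_invertible)
  show "t_mult I J = t_mult J I"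
    by (rule t_mult_commute)
  show "t_mult (t_mult I J) K = t_mult I (t_mult J K)" if "K \<in> invertible_t_ideals" for K
    using I J that by (intro t_mult_assoc invertible_t_idealD(1))
next
  fix I assume I: "I \<in> invertible_t_ideals"
  show "t_mult D I = I"
    using I by (intro t_mult_one invertible_t_idealD(4))
  show "\<exists>J\<in>invertible_t_ideals. t_mult J I = D"
    using inverse_invertible[OF I] invertible_t_idealD(3)[OF I] by (metis t_mult_commute)
qed

lemma principal_subgroup: "subgroup {principal D c | c. c \<noteq> 0} (t_ideal_group D)"
proof (rule group.subgroupI[OF comm_group.axioms(2)[OF t_ideal_comm_group]], simp_all only: t_ideal_group_simps)
  interpret G: comm_group "t_ideal_group D"
    by (rule t_ideal_comm_group)
  show "{principal D c | c. c \<noteq> 0} \<subseteq> invertible_t_ideals"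
    using principal_invertible by blast
  show "{principal D c | c. c \<noteq> 0} \<noteq> {}"
    by (auto intro: exI[of _ 1])
  fix I assume "I \<in> {principal D c | c. c \<noteq> 0}"
  then obtain c where c: "I = principal D c" "c \<noteq> 0"
    by blast
  have "t_mult (principal D (1 / c)) I = D"
    using c by (simp add: t_mult_principal principal_one)
  then have "inv\<^bsub>t_ideal_group D\<^esub> I = principal D (1 / c)"
    using c principal_invertible by (intro G.inv_equality) simp_all
  then show "inv\<^bsub>t_ideal_group D\<^esub> I \<in> {principal D c | c. c \<noteq> 0}"
    using c by (auto intro!: exI[of _ "1 / c"])
  fix J assume "J \<in> {principal D c | c. c \<noteq> 0}"
  then obtain d where d: "J = principal D d" "d \<noteq> 0"
    by blast
  then show "t_mult I J \<in> {principal D c | c. c \<noteq> 0}"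
    using c by (auto simp: t_mult_principal intro!: exI[of _ "c * d"])
qed

lemma torsion_t_class_group:
  assumes "\<And>I. I \<in> invertible_t_ideals \<Longrightarrow> \<exists>n\<ge>1. \<exists>q. q \<noteq> 0 \<and> I [^]\<^bsub>t_ideal_group D\<^esub> (n::nat) = principal D q"
  shows "is_torsion_group (t_class_group D)"
proof -
  let ?G = "t_ideal_group D" and ?H = "{principal D c | c. c \<noteq> 0}"
  interpret G: comm_group ?G
    by (rule t_ideal_comm_group)
  interpret H: normal ?H ?G
    using principal_subgroup by (rule G.subgroup_imp_normal)
  have "\<exists>n\<ge>1. X [^]\<^bsub>?G Mod ?H\<^esub> (n::nat) = ?H" if "X \<in> carrier (?G Mod ?H)" for X
  proof -
    from that[unfolded carrier_FactGroup] obtain I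
      where X: "X = ?H #>\<^bsub>?G\<^esub> I" and I: "I \<in> carrier ?G"
      by (rule imageE)
    then obtain n :: nat and q where n: "n \<ge> 1" "q \<noteq> 0" "I [^]\<^bsub>?G\<^esub> n = principal D q"
      using assms[of I] by auto
    have "X [^]\<^bsub>?G Mod ?H\<^esub> n = ?H #>\<^bsub>?G\<^esub> (I [^]\<^bsub>?G\<^esub> n)"
      unfolding X by (rule H.FactGroup_pow[OF I])
    also have "\<dots> = ?H"
    proof (rule G.coset_join2[OF G.nat_pow_closed[OF I] principal_subgroup])
      show "I [^]\<^bsub>?G\<^esub> n \<in> ?H"
        using n(2,3) by blast
    qed
    finally show ?thesis
      using n(1) by blast
  qed
  then show ?thesis
    unfolding is_torsion_group_def t_class_group_def using H.factorgroup_is_group by simp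
qed

text \<open>That 1 lies in the \<open>t\<close>-closure of I I^(-1) involves only finitely many
  elements, \<open>A\<close> from \<open>I\<close> and \<open>B\<close> from the inverse. If y A
  \<subseteq> D and x \<in> I, then (y x)(a b) = (y a)(b x) \<in> D for all a \<in> A and b \<in> B,
  hence y x \<in> D.\<close>

lemma invertible_finite_type:
  assumes "I \<in> invertible_t_ideals"
  shows "\<exists>A. finite A \<and> A \<subseteq> I \<and> \<not> A \<subseteq> {0} \<and> I = v_closure D A"
proof -
  note I = invertible_t_idealD[OF assms]
  let ?I' = "ideal_inverse D I"
  \<comment> \<open>\<open>Q F\<close> says that products of finitely many elements of
    \<open>I\<close> and of its inverse span a module containing \<open>F\<close>.\<close>
  define Q where "Q = (\<lambda>F. \<exists>A B. finite A \<and> finite B \<and> A \<subseteq> I \<and> B \<subseteq> ?I' \<and>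
    F \<subseteq> is_submodule D hull {a * b | a b. a \<in> A \<and> b \<in> B})"
  have hull_mono': "is_submodule D hull {a * b | a b. a \<in> A \<and> b \<in> B}
      \<subseteq> is_submodule D hull {a * b | a b. a \<in> A' \<and> b \<in> B'}" if "A \<subseteq> A'" "B \<subseteq> B'" for A B A' B' :: "'k set"
    using that by (intro hull_mono) blast
  have Q_Un: "Q (F \<union> G)" if FG: "Q F" "Q G" for F G
  proof -
    obtain A B where AB: "finite A" "finite B" "A \<subseteq> I" "B \<subseteq> ?I'"
      "F \<subseteq> is_submodule D hull {a * b | a b. a \<in> A \<and> b \<in> B}"
      using FG(1) unfolding Q_def by blast
    obtain A' B' where AB': "finite A'" "finite B'" "A' \<subseteq> I" "B' \<subseteq> ?I'"
      "G \<subseteq> is_submodule D hull {a * b | a b. a \<in> A' \<and> b \<in> B'}"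
      using FG(2) unfolding Q_def by blast
    have "F \<union> G \<subseteq> is_submodule D hull {a * b | a b. a \<in> A \<union> A' \<and> b \<in> B \<union> B'}"
      using AB(5) AB'(5) hull_mono'[of A "A \<union> A'" B "B \<union> B'"] hull_mono'[of A' "A \<union> A'" B' "B \<union> B'"]
      by blast
    moreover have "finite (A \<union> A')" "finite (B \<union> B')" "A \<union> A' \<subseteq> I" "B \<union> B' \<subseteq> ?I'"
      using AB AB' by auto
    ultimately show ?thesis
      unfolding Q_def by (intro exI conjI)
  qed
  have "ideal_mult D I ?I' \<subseteq> {x. Q {x}}"
  proof (rule ideal_mult_least)
    fix a b assume "a \<in> I" "b \<in> ?I'"
    moreover have "a * b \<in> is_submodule D hull {x * y | x y. x \<in> {a} \<and> y \<in> {b}}"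
      by (rule hull_inc) blast
    ultimately show "a * b \<in> {x. Q {x}}"
      unfolding Q_def mem_Collect_eq by (intro exI[of _ "{a}"] exI[of _ "{b}"] conjI) simp_all
  next
    show "is_submodule D {x. Q {x}}"
      unfolding is_submodule_def mem_Collect_eq
    proof (intro conjI ballI, unfold mem_Collect_eq)
      show "Q {0}"
        unfolding Q_def using submodule_zero[OF submodule_hull] by blast
    next
      fix x y assume "Q {x}" "Q {y}"
      then have "Q {x, y}"
        using Q_Un[of "{x}" "{y}"] by (simp add: insert_commute)
      then show "Q {x + y}"
        unfolding Q_def using submodule_add[OF submodule_hull] by (metis (no_types, lifting) empty_subsetI insert_subset)
    next
      fix r x assume "r \<in> D" "Q {x}"
      then show "Q {r * x}"
        unfolding Q_def using submodule_mult[OF submodule_hull] by (metis (no_types, lifting) empty_subsetI insert_subset)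
    qed
  qed
  then have Q_single: "Q {x}" if "x \<in> ideal_mult D I ?I'" for x
    using that by blast
  have Q_finite: "Q F" if "finite F" "F \<subseteq> ideal_mult D I ?I'" for F
    using that
  proof (induction F)
    case empty
    show ?case
      unfolding Q_def by blast
  next
    case (insert x F)
    then show ?case
      using Q_Un[OF Q_single[of x], of F] by simp
  qed
  obtain F where F: "finite F" "F \<subseteq> ideal_mult D I ?I'" "\<not> F \<subseteq> {0}" "1 \<in> v_closure D F"
    using I(3) subring_one[OF D] mem_t_closure[OF ideal_mult_submodule, of 1 I ?I'] by metis
  obtain A B where AB: "finite A" "finite B" "A \<subseteq> I" "B \<subseteq> ?I'"
    "F \<subseteq> is_submodule D hull {a * b | a b. a \<in> A \<and> b \<in> B}"
    using Q_finite[OF F(1,2)] unfolding Q_def by blast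
  have one: "1 \<in> v_closure D {a * b | a b. a \<in> A \<and> b \<in> B}"
    using F(4) v_closure_mono[OF AB(5)] v_closure_hull by blast
  have "I \<subseteq> v_closure D A"
  proof
    fix x assume x: "x \<in> I"
    show "x \<in> v_closure D A"
      unfolding mem_v_closure
    proof (intro allI impI)
      fix y assume y: "\<forall>a\<in>A. y * a \<in> D"
      have "(y * x) * (a * b) \<in> D" if "a \<in> A" "b \<in> B" for a b
      proof -
        have "b * x \<in> D"
          using AB(4) that x by (auto simp: ideal_inverse_def)
        moreover have "y * a \<in> D"
          using y that by blast
        ultimately have "(y * a) * (b * x) \<in> D"
          by (metis subring_mult[OF D])
        then show ?thesis
          by (simp add: ac_simps)
      qed
      then have "\<forall>f\<in>{a * b | a b. a \<in> A \<and> b \<in> B}. (y * x) * f \<in> D"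
        by blast
      then have "(y * x) * 1 \<in> D"
        using one unfolding mem_v_closure by blast
      then show "y * x \<in> D"
        by simp
    qed
  qed
  \<comment> \<open>A nonzero element of \<open>I\<close> is added to \<open>A\<close> so that the
    generating set is visibly not contained in {0}.\<close>
  moreover obtain x where x: "x \<in> I" "x \<noteq> 0"
    using nonzero_frac_idealD(3)[OF I(1)] by blast
  moreover have "v_closure D A \<subseteq> v_closure D (insert x A)"
    by (intro v_closure_mono) blast
  moreover have "v_closure D (insert x A) \<subseteq> I"
    using AB(1,3) x by (intro t_closedD[OF I(2)]) auto
  ultimately show ?thesis
    using AB(1,3) by (intro exI[of _ "insert x A"]) auto
qed

end

section \<open>Integrally closed AGCD domains\<close>

text \<open>\<open>x\<close> is a root of the monic polynomial T^n - x^n.\<close>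

lemma integrally_closed_root_closed:
  assumes "is_subring R" "is_integrally_closed R" "x \<in> quotient_field R" "x ^ n \<in> R" "n \<ge> 1"
  shows "x \<in> R"
proof -
  let ?p = "monom 1 n + [:- (x ^ n):]"
  have deg: "degree ?p = n"
    using assms(5) by (subst degree_add_eq_left) (simp_all add: degree_monom_eq)
  have "lead_coeff ?p = 1"
    using assms(5) unfolding deg by (simp add: coeff_pCons split: nat.splits)
  moreover have "coeff ?p i \<in> R" for i
    using subring_zero[OF assms(1)] subring_one[OF assms(1)] subring_uminus[OF assms(1,4)] assms(5)
    by (auto simp: coeff_pCons split: nat.splits)
  moreover have "poly ?p x = 0"
    by (simp add: poly_monom)
  ultimately have "is_integral_over R x"
    unfolding is_integral_over_def by blast
  then show ?thesis
    using assms(2,3) unfolding is_integrally_closed_def by blast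
qed

context domain_in_field
begin

text \<open>
  \<open>q\<close> is a greatest common divisor of \<open>A\<close> in the strong sense that \<open>(A)\<^sub>v = (q)\<close>.
\<close>

definition is_gcd_of :: "'k set \<Rightarrow> 'k \<Rightarrow> bool" where
  "is_gcd_of A q \<longleftrightarrow> q \<noteq> 0 \<and> (\<forall>a\<in>A. a / q \<in> D) \<and> q \<in> v_closure D A"

text \<open>
  The exponents of the elements of \<open>B\<close> have to vary independently: each factor \<open>b\<close> of \<open>y\<close> lowers
  one of them.
\<close>

lemma coprime_independent_powers:
  fixes e :: "'k \<Rightarrow> nat"
  assumes "finite B" "B \<subseteq> D" "1 \<in> v_closure D B" "\<And>b. b \<in> B \<Longrightarrow> y * b ^ e b \<in> D"
  shows "y \<in> D"
  using assms(4)
proof (induction "sum e B" arbitrary: e y rule: less_induct)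
  case less
  show ?case
  proof (cases "\<exists>b\<in>B. e b = 0")
    case True
    then show ?thesis
      using less.prems by force
  next
    case False
    have "y * b \<in> D" if b: "b \<in> B" for b
    proof -
      define e' where "e' = e(b := e b - 1)"
      have "sum e' B < sum e B"
        using assms(1) b False by (intro sum_strict_mono_ex1) (auto simp: e'_def)
      moreover have "y * b * c ^ e' c \<in> D" if c: "c \<in> B" for c
      proof (cases "c = b")
        case True
        have "e b = Suc (e b - 1)"
          using False b by auto
        then have "y * b * b ^ (e b - 1) = y * b ^ e b"
          by (metis mult.assoc power_Suc)
        then show ?thesis
          using True less.prems[OF b] unfolding e'_def fun_upd_apply by metis
      next
        case False
        have "b * (y * c ^ e c) \<in> D"
          using assms(2) b by (intro subring_mult[OF D _ less.prems[OF c]]) auto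
        then show ?thesis
          using False by (simp add: e'_def ac_simps)
      qed
      ultimately show ?thesis
        by (rule less.hyps)
    qed
    \<comment> \<open>All products y b lie in \<open>D\<close>, so coprimality of \<open>B\<close>
      removes the factor.\<close>
    then have "y * 1 \<in> D"
      using assms(3) unfolding mem_v_closure by blast
    then show ?thesis
      by simp
  qed
qed

lemma coprime_powers:
  assumes "finite B" "B \<subseteq> D" "1 \<in> v_closure D B"
  shows "1 \<in> v_closure D ((\<lambda>b. b ^ k) ` B)"
  unfolding mem_v_closure
proof (intro allI impI)
  fix y assume "\<forall>f\<in>(\<lambda>b. b ^ k) ` B. y * f \<in> D"
  then show "y * 1 \<in> D"
    using coprime_independent_powers[OF assms, of y "\<lambda>_. k"] by simp
qed

lemma is_gcd_of_scale:
  assumes "is_gcd_of A q"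
  shows "(\<lambda>a. a / q) ` A \<subseteq> D" "1 \<in> v_closure D ((\<lambda>a. a / q) ` A)"
proof -
  show "(\<lambda>a. a / q) ` A \<subseteq> D"
    using assms by (auto simp: is_gcd_of_def)
  show "1 \<in> v_closure D ((\<lambda>a. a / q) ` A)"
    unfolding mem_v_closure
  proof (intro allI impI)
    fix y assume "\<forall>f\<in>(\<lambda>a. a / q) ` A. y * f \<in> D"
    then have "\<forall>a\<in>A. (y / q) * a \<in> D"
      by simp
    then have "(y / q) * q \<in> D"
      using assms unfolding is_gcd_of_def mem_v_closure by blast
    then show "y * 1 \<in> D"
      using assms by (simp add: is_gcd_of_def)
  qed
qed

text \<open>Dividing by \<open>q\<close> reduces this to powers of coprime elements. It allows
  greatest common divisors found at different exponents to be combined at a common one.\<close>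

lemma is_gcd_of_power:
  assumes "finite A" "is_gcd_of A q"
  shows "is_gcd_of ((\<lambda>a. a ^ k) ` A) (q ^ k)"
proof -
  have q: "q \<noteq> 0"
    using assms(2) by (simp add: is_gcd_of_def)
  have one: "1 \<in> v_closure D ((\<lambda>b. b ^ k) ` (\<lambda>a. a / q) ` A)"
    using assms(1) is_gcd_of_scale[OF assms(2)] by (intro coprime_powers) auto
  have "q ^ k \<in> v_closure D ((\<lambda>a. a ^ k) ` A)"
    unfolding mem_v_closure
  proof (intro allI impI)
    fix y assume y: "\<forall>f\<in>(\<lambda>a. a ^ k) ` A. y * f \<in> D"
    have "(y * q ^ k) * (a / q) ^ k = y * a ^ k" for a
      using q by (simp add: power_divide)
    with y have "\<forall>f\<in>(\<lambda>b. b ^ k) ` (\<lambda>a. a / q) ` A. (y * q ^ k) * f \<in> D"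
      unfolding ball_simps by metis
    then have "(y * q ^ k) * 1 \<in> D"
      using one unfolding mem_v_closure by blast
    then show "y * q ^ k \<in> D"
      by simp
  qed
  moreover have "(a / q) ^ k \<in> D" if "a \<in> A" for a
    using assms(2) that by (intro subring_power[OF D]) (simp add: is_gcd_of_def)
  ultimately show ?thesis
    using q by (auto simp: is_gcd_of_def power_divide)
qed

end

locale integrally_closed_AGCD_domain = domain_in_field +
  assumes agcd: "is_AGCD D" and ic: "is_integrally_closed D"
begin

lemma root_closed: "x ^ n \<in> D \<Longrightarrow> n \<ge> 1 \<Longrightarrow> x \<in> D"
  using integrally_closed_root_closed[OF D ic, of x n] quot by simp

text \<open>A generator \<open>c\<close> of the intersection is a least common multiple of
  \<open>a ^ n\<close> and \<open>b ^ n\<close>, so a^n b^n / c is their greatest common divisor.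
  \<open>x\<close> and \<open>y\<close> may be any nonzero field elements, whence the scaling by a
  common denominator \<open>d\<close>.\<close>

lemma exists_gcd_powers_pair:
  assumes "x \<noteq> 0" "y \<noteq> 0"
  shows "\<exists>n\<ge>1. \<exists>g. is_gcd_of {x ^ n, y ^ n} g"
proof -
  obtain d where d: "d \<in> D" "d \<noteq> 0" "d * x \<in> D" "d * y \<in> D"
    using common_denominator[of "{x, y}"] by auto
  define a b where "a = d * x" and "b = d * y"
  have ab: "a \<in> D" "b \<in> D" "a \<noteq> 0" "b \<noteq> 0"
    using d assms by (auto simp: a_def b_def)
  obtain n c where n: "n \<ge> 1" and c: "principal D (a ^ n) \<inter> principal D (b ^ n) = principal D c"
    using agcd ab unfolding is_AGCD_def by (metis Diff_iff singletonD)
  have an: "a ^ n \<noteq> 0" "b ^ n \<noteq> 0"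
    using ab by auto
  have lcm: "z / a ^ n \<in> D \<and> z / b ^ n \<in> D \<longleftrightarrow> z \<in> principal D c" for z
    using c in_principal_iff[OF an(1), of z D] in_principal_iff[OF an(2), of z D] by blast
  have "a ^ n * b ^ n \<in> principal D c"
    using lcm[of "a ^ n * b ^ n"] an ab subring_power[OF D] by simp
  then have "c \<noteq> 0"
    using an by (auto simp: principal_def)
  then have lcm': "z / a ^ n \<in> D \<and> z / b ^ n \<in> D \<longleftrightarrow> z / c \<in> D" for z
    using lcm in_principal_iff by blast
  \<comment> \<open>This is a^n b^n / c with the factor d^n removed again.\<close>
  define g where "g = x ^ n * (b ^ n / c)"
  have "is_gcd_of {x ^ n, y ^ n} g"
    unfolding is_gcd_of_def mem_v_closure
  proof (intro conjI ballI allI impI)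
    show "g \<noteq> 0"
      using assms an \<open>c \<noteq> 0\<close> by (simp add: g_def)
    have "c / a ^ n \<in> D" "c / b ^ n \<in> D"
      using lcm'[of c] \<open>c \<noteq> 0\<close> subring_one[OF D] by auto
    moreover have "x ^ n / g = c / b ^ n" "y ^ n / g = c / a ^ n"
      using assms an \<open>c \<noteq> 0\<close> d(2) by (simp_all add: g_def a_def b_def power_mult_distrib)
    ultimately show "f / g \<in> D" if "f \<in> {x ^ n, y ^ n}" for f
      using that by auto
  next
    fix w assume w: "\<forall>f\<in>{x ^ n, y ^ n}. w * f \<in> D"
    \<comment> \<open>A multiplier \<open>w\<close> taking x^n and y^n into \<open>D\<close> turns
      into a common multiple of a^n and b^n.\<close>
    define z where "z = w * x ^ n * b ^ n"
    have "z / a ^ n = w * y ^ n" "z / b ^ n = w * x ^ n"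
      using assms an d(2) by (simp_all add: z_def a_def b_def power_mult_distrib)
    then have "z / c \<in> D"
      using w lcm'[of z] by simp
    then show "w * g \<in> D"
      by (simp add: z_def g_def mult.assoc)
  qed
  then show ?thesis
    using n by blast
qed

text \<open>To adjoin \<open>b\<close>, the old exponent n is multiplied by some k at which
  \<open>q\<close> and \<open>b ^ n\<close> have a greatest common divisor \<open>r\<close>. By
  \<open>is_gcd_of_power\<close> the old divisor becomes \<open>q ^ k\<close>, so \<open>r\<close>
  serves for the exponent n k.\<close>

lemma exists_gcd_powers:
  assumes "finite A" "A \<noteq> {}" "0 \<notin> A"
  shows "\<exists>n\<ge>1. \<exists>q. is_gcd_of ((\<lambda>a. a ^ n) ` A) q"
  using assms
proof (induction A rule: finite_ne_induct)
  case (singleton x)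
  then have "is_gcd_of ((\<lambda>a. a ^ 1) ` {x}) x"
    using subring_one[OF D] by (simp add: is_gcd_of_def mem_v_closure)
  then show ?case
    by (intro exI[of _ 1]) blast
next
  case (insert b A)
  then obtain n q where n: "n \<ge> 1" and q: "is_gcd_of ((\<lambda>a. a ^ n) ` A) q"
    by auto
  obtain k r where k: "k \<ge> 1" and r: "is_gcd_of {q ^ k, (b ^ n) ^ k} r"
    using exists_gcd_powers_pair[of q "b ^ n"] insert.prems q by (auto simp: is_gcd_of_def)
  have qk: "is_gcd_of ((\<lambda>a. a ^ k) ` (\<lambda>a. a ^ n) ` A) (q ^ k)"
    using insert.hyps(1) q by (intro is_gcd_of_power) auto
  have q0: "q ^ k \<noteq> 0" and r0: "r \<noteq> 0"
    using qk r by (auto simp: is_gcd_of_def)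
  have "is_gcd_of ((\<lambda>a. a ^ (n * k)) ` insert b A) r"
    unfolding is_gcd_of_def mem_v_closure
  proof (intro conjI ballI allI impI r0)
    fix f assume "f \<in> (\<lambda>a. a ^ (n * k)) ` insert b A"
    then consider "f = (b ^ n) ^ k" | a where "a \<in> A" "f = (a ^ n) ^ k"
      by (auto simp: power_mult)
    then show "f / r \<in> D"
    proof cases
      case 1
      have "(b ^ n) ^ k / r \<in> D"
        using r unfolding is_gcd_of_def by blast
      then show ?thesis
        unfolding 1 .
    next
      case 2
      have "q ^ k / r \<in> D" "f / q ^ k \<in> D"
        using r qk 2 unfolding is_gcd_of_def by blast+
      then have "(f / q ^ k) * (q ^ k / r) \<in> D"
        by (metis subring_mult[OF D])
      also have "(f / q ^ k) * (q ^ k / r) = f / r"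
        using q0 by simp
      finally show ?thesis .
    qed
  next
    fix y assume y: "\<forall>f\<in>(\<lambda>a. a ^ (n * k)) ` insert b A. y * f \<in> D"
    then have "y * q ^ k \<in> D"
      using qk by (simp add: is_gcd_of_def mem_v_closure power_mult)
    then have "\<forall>f\<in>{q ^ k, (b ^ n) ^ k}. y * f \<in> D"
      using y by (simp add: power_mult)
    then show "y * r \<in> D"
      using r unfolding is_gcd_of_def mem_v_closure by blast
  qed
  then show ?case
    using n k by (intro exI[of _ "n * k"]) auto
qed

text \<open>The fraction x / y in lowest terms, up to a power: x^n / y^n = u / v. The common factor
  \<open>g\<close> is in general only an element of the field.\<close>

lemma exists_coprime_fraction:
  assumes "x \<noteq> 0" "y \<noteq> 0"
  obtains n g u v where "n \<ge> 1" "u \<in> D" "v \<in> D" "x ^ n = g * u" "y ^ n = g * v" "1 \<in> v_closure D {u, v}"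
proof -
  obtain n g where n: "n \<ge> 1" and g: "is_gcd_of {x ^ n, y ^ n} g"
    using exists_gcd_powers_pair[OF assms] by blast
  have "g \<noteq> 0"
    using g by (simp add: is_gcd_of_def)
  then show ?thesis
    using that[of n "x ^ n / g" "y ^ n / g" g] is_gcd_of_scale[OF g] n by simp
qed

text \<open>For a list of length n the value is the n-th power of
  \<open>prod_list l / q\<close>.\<close>

lemma prod_list_divide_power: "prod_list (map (\<lambda>a. a ^ n / q) l) = prod_list l ^ n / q ^ length l"
  for q :: "'b::field"
  by (induction l) (simp_all add: power_mult_distrib)

lemma t_power_invertible:
  assumes "I \<in> invertible_t_ideals"
  shows "I [^]\<^bsub>t_ideal_group D\<^esub> (k::nat) \<in> invertible_t_ideals"
proof -
  interpret G: comm_group "t_ideal_group D"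
    by (rule t_ideal_comm_group)
  show ?thesis
    using G.nat_pow_closed[of I k] assms by simp
qed

lemma t_power_mem:
  assumes I: "I \<in> invertible_t_ideals" and a: "a \<in> I"
  shows "a ^ k \<in> I [^]\<^bsub>t_ideal_group D\<^esub> (k::nat)"
proof (induction k)
  case (Suc k)
  then have "a ^ k * a \<in> t_mult (I [^]\<^bsub>t_ideal_group D\<^esub> k) I"
    using a I t_power_invertible[OF I] by (intro t_mult_mem invertible_t_idealD(1))
  then show ?case
    by (simp add: mult.commute)
qed (use subring_one[OF D] in simp)

text \<open>
  If \<open>I = (a\<^sub>1, \<dots>, a\<^sub>m)\<^sub>v\<close> and \<open>q\<close> is the greatest common divisor of \<open>a\<^sub>1\<^sup>n, \<dots>, a\<^sub>m\<^sup>n\<close>, then every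
  product of \<open>n\<close> of the \<open>a\<^sub>i\<close> is a multiple of \<open>q\<close>, because its \<open>n\<close>-th power is a multiple of \<open>q\<^sup>n\<close>.
\<close>

lemma invertible_power_principal:
  assumes I: "I \<in> invertible_t_ideals"
  shows "\<exists>n\<ge>1. \<exists>q. q \<noteq> 0 \<and> I [^]\<^bsub>t_ideal_group D\<^esub> (n::nat) = principal D q"
proof -
  let ?G = "t_ideal_group D"
  note pow = t_power_invertible[OF I]
  obtain A where A: "finite A" "A \<subseteq> I" "\<not> A \<subseteq> {0}" "I = v_closure D A"
    using invertible_finite_type[OF I] by blast
  obtain n q where n: "n \<ge> 1" and q: "is_gcd_of ((\<lambda>a. a ^ n) ` (A - {0})) q"
    using exists_gcd_powers[of "A - {0}"] A(1,3) by auto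
  have q0: "q \<noteq> 0"
    using q by (simp add: is_gcd_of_def)
  \<comment> \<open>Zero was left out of the greatest common divisor; for it the claim holds because
    n \<ge> 1 makes \<open>0 ^ n\<close> vanish.\<close>
  have div: "a ^ n / q \<in> D" if "a \<in> A" for a
    using q that n subring_zero[OF D] by (cases "a = 0") (auto simp: is_gcd_of_def power_0_left)
  \<comment> \<open>By induction the factors of the \<open>t\<close>-power are replaced one at a
    time by generators from \<open>A\<close>.\<close>
  have "I [^]\<^bsub>?G\<^esub> k \<subseteq> v_closure D {prod_list l | l. length l = k \<and> set l \<subseteq> A}" for k :: nat
  proof (induction k)
    case 0
    have "v_closure D {1} = D"
    proof
      show "v_closure D {1} \<subseteq> D"
        using t_closedD[OF t_closed_D, of "{1}"] subring_one[OF D] by simp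
      show "D \<subseteq> v_closure D {1}"
        using subring_mult[OF D] by (auto simp: mem_v_closure)
    qed
    then show ?case
      by simp
  next
    case (Suc k)
    let ?M = "v_closure D {prod_list l | l. length l = Suc k \<and> set l \<subseteq> A}"
    have "t_mult (I [^]\<^bsub>?G\<^esub> k) I \<subseteq> ?M"
    proof (rule t_mult_least[OF t_closed_v_closure])
      fix x b assume x: "x \<in> I [^]\<^bsub>?G\<^esub> k" and b: "b \<in> I"
      show "x * b \<in> ?M"
        unfolding mem_v_closure
      proof (intro allI impI)
        fix y assume y: "\<forall>f\<in>{prod_list l | l. length l = Suc k \<and> set l \<subseteq> A}. y * f \<in> D"
        have "(y * b) * prod_list l \<in> D" if l: "length l = k" "set l \<subseteq> A" for l
        proof -
          have "(y * prod_list l) * a \<in> D" if "a \<in> A" for a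
          proof -
            have "y * prod_list (a # l) \<in> D"
              using y l that by (metis (mono_tags, lifting) CollectI insert_subset length_Cons list.simps(15))
            then show ?thesis
              by (simp add: ac_simps)
          qed
          then have "(y * prod_list l) * b \<in> D"
            using b unfolding A(4) mem_v_closure by blast
          then show ?thesis
            by (simp add: ac_simps)
        qed
        then have "\<forall>f\<in>{prod_list l | l. length l = k \<and> set l \<subseteq> A}. (y * b) * f \<in> D"
          by blast
        then have "(y * b) * x \<in> D"
          using x Suc.IH unfolding mem_v_closure subset_iff by blast
        then show "y * (x * b) \<in> D"
          by (simp add: ac_simps)
      qed
    qed
    then show ?case
      by simp
  qed
  moreover have "prod_list l / q \<in> D" if l: "length l = n" "set l \<subseteq> A" for l
  proof -
    have "prod_list (map (\<lambda>a. a ^ n / q) l) \<in> D"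
      using l(2) div by (intro subring_prod_list[OF D]) auto
    then have "(prod_list l / q) ^ n \<in> D"
      using l(1) by (simp add: prod_list_divide_power power_divide)
    then show ?thesis
      using root_closed n by blast
  qed
  then have "\<forall>f\<in>{prod_list l | l. length l = n \<and> set l \<subseteq> A}. (1 / q) * f \<in> D"
    by auto
  ultimately have "(1 / q) * z \<in> D" if "z \<in> I [^]\<^bsub>?G\<^esub> n" for z
    using that unfolding mem_v_closure subset_iff by blast
  then have "I [^]\<^bsub>?G\<^esub> n \<subseteq> principal D q"
    using q0 by (auto simp: in_principal_iff)
  moreover have "principal D q \<subseteq> I [^]\<^bsub>?G\<^esub> n"
  proof -
    \<comment> \<open>For the reverse inclusion, \<open>q\<close> lies in the
      \<open>v\<close>-closure of the n-th powers of generators, all of which belong to the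
      \<open>t\<close>-closed ideal I^n.\<close>
    have "v_closure D ((\<lambda>a. a ^ n) ` (A - {0})) \<subseteq> I [^]\<^bsub>?G\<^esub> n"
      using A t_power_mem[OF I, of _ n] by (intro t_closedD[OF invertible_t_idealD(2)[OF pow]]) auto
    then have "q \<in> I [^]\<^bsub>?G\<^esub> n"
      using q by (auto simp: is_gcd_of_def)
    then show ?thesis
      using submodule_mult[OF t_closed_submodule[OF invertible_t_idealD(2)[OF pow]], of _ q n]
      by (auto simp: principal_def mult.commute)
  qed
  ultimately show ?thesis
    using n q0 by blast
qed

text \<open>\<open>q\<close> generates a principal \<open>t\<close>-power of \<open>I\<close>. It
  lies in \<open>I\<close> because n \<ge> 1 and \<open>I\<close> is integral, and that
  \<open>t\<close>-power contains the n-th power of every element of \<open>I\<close>. Thus a prime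
  contains \<open>q\<close> exactly if it contains \<open>I\<close>.\<close>

lemma integral_invertible_power:
  assumes I: "I \<in> invertible_t_ideals" "I \<subseteq> D"
  shows "\<exists>n\<ge>1. \<exists>q\<in>I. \<forall>a\<in>I. a ^ n \<in> principal D q"
proof -
  let ?G = "t_ideal_group D"
  obtain n q where n: "n \<ge> 1" "q \<noteq> 0" "I [^]\<^bsub>?G\<^esub> (n::nat) = principal D q"
    using invertible_power_principal[OF I(1)] by blast
  have sub_I: "t_mult J I \<subseteq> I" if "J \<subseteq> D" for J
    using that invertible_t_idealD(2)[OF I(1)]
    by (intro t_mult_least) (auto intro: submodule_mult[OF t_closed_submodule])
  have "I [^]\<^bsub>?G\<^esub> (k::nat) \<subseteq> D" for k
  proof (induction k)
    case (Suc k)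
    then show ?case
      using sub_I I(2) by auto
  qed simp
  then have "I [^]\<^bsub>?G\<^esub> n \<subseteq> I"
    using sub_I n(1) by (cases n) auto
  moreover have "q \<in> principal D q"
    using n(2) subring_one[OF D] by (simp add: in_principal_iff)
  ultimately have "q \<in> I"
    using n(3) by blast
  moreover have "\<forall>a\<in>I. a ^ n \<in> principal D q"
    using t_power_mem[OF I(1)] n(3) by metis
  ultimately show ?thesis
    using n(1) by blast
qed

text \<open>Some power of \<open>x\<close> is a quotient u / v of coprime elements. If one of the
  two is outside \<open>P\<close>, root closedness puts \<open>x\<close> or its inverse into D_P.
  Both in \<open>P\<close> would produce a smaller nonzero prime.\<close>

lemma localization_valuation:
  assumes P: "is_minimal_nonzero_prime D P" and "x \<noteq> 0"
  shows "x \<in> localization D P \<or> inverse x \<in> localization D P"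
proof -
  have P': "is_prime_ideal D P"
    using P by (simp add: is_minimal_nonzero_prime_def)
  \<comment> \<open>From z^n = c / s the product z s has n-th power c s^(n-1) in \<open>D\<close>,
    so z s \<in> D.\<close>
  have root: "z \<in> localization D P" if z: "z ^ n = c / s" "n \<ge> 1" "c \<in> D" "s \<in> D - P" for z c s n
  proof -
    have "s \<noteq> 0"
      using z(4) prime_ideal_zero[OF P'] by auto
    have "s ^ n = s * s ^ (n - 1)"
      using z(2) by (simp add: power_eq_if)
    then have "(z * s) ^ n = c * s ^ (n - 1)"
      using z(1) \<open>s \<noteq> 0\<close> by (simp add: power_mult_distrib)
    also have "\<dots> \<in> D"
      using z by (auto intro: subring_mult[OF D] subring_power[OF D])
    finally have "z * s \<in> D"
      using root_closed z(2) by blast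
    moreover have "z = z * s / s"
      using \<open>s \<noteq> 0\<close> by simp
    ultimately show ?thesis
      using z(4) unfolding localization_def by blast
  qed
  obtain a b where ab: "x = a / b" "a \<in> D" "b \<in> D" "b \<noteq> 0"
    by (rule fractionE)
  then have "a \<noteq> 0"
    using assms(2) by auto
  obtain n g u v where n: "n \<ge> 1" and uv: "u \<in> D" "v \<in> D" "a ^ n = g * u" "b ^ n = g * v"
    and coprime: "1 \<in> v_closure D {u, v}"
    by (rule exists_coprime_fraction[OF \<open>a \<noteq> 0\<close> \<open>b \<noteq> 0\<close>])
  have "g * u \<noteq> 0" "g * v \<noteq> 0"
    using \<open>a \<noteq> 0\<close> \<open>b \<noteq> 0\<close> by (simp_all flip: uv(3,4))
  then have nz: "g \<noteq> 0" "u \<noteq> 0" "v \<noteq> 0"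
    by auto
  have eqs: "x ^ n = u / v" "inverse x ^ n = v / u"
    using nz uv(3,4) by (simp_all add: ab(1) power_divide inverse_eq_divide)
  have "u \<notin> P \<or> v \<notin> P"
  proof (rule ccontr)
    assume "\<not> ?thesis"
    then have uvP: "u \<in> P" "v \<in> P"
      by auto
    \<comment> \<open>The multiplicative set generated by \<open>v\<close> and the complement of
      \<open>P\<close>: a prime disjoint from it lies in \<open>P\<close> and omits
      \<open>v\<close>. One that contains \<open>u\<close> is also nonzero, against
      minimality.\<close>
    define S where "S = {v ^ k * s | k s. s \<in> D - P}"
    \<comment> \<open>Coprimality lets the powers of \<open>v\<close> be cancelled one by one from a
      multiple of \<open>u\<close>.\<close>
    have cancel: "s / u \<in> D" if "v ^ k * s / u \<in> D" "s \<in> D" for k s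
      using that
    proof (induction k)
      case (Suc k)
      have "v ^ k * s / u * u \<in> D"
        using nz uv Suc.prems(2) by (simp add: subring_mult[OF D] subring_power[OF D])
      moreover have "v ^ k * s / u * v \<in> D"
        using Suc.prems(1) by (simp add: ac_simps)
      ultimately have "v ^ k * s / u * 1 \<in> D"
        using coprime unfolding mem_v_closure by blast
      then show ?case
        using Suc by simp
    qed simp
    have one: "1 \<in> D - P"
      using subring_one[OF D] prime_ideal_one[OF P'] by blast
    have S_base: "v ^ k * s \<in> S" if "s \<in> D - P" for k s
      using that unfolding S_def by blast
    have "is_ideal D (principal D u)"
      using t_closed_submodule[OF t_closed_principal[OF nz(2)]] uv(1)
      by (auto simp: is_ideal_def principal_def subring_mult[OF D])
    moreover have "1 \<in> S"
      using S_base[OF one, of 0] by simp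
    moreover have "y * z \<in> S" if yz: "y \<in> S" "z \<in> S" for y z
    proof -
      obtain k s l t where "y = v ^ k * s" "z = v ^ l * t" "s \<in> D - P" "t \<in> D - P"
        using yz unfolding S_def by blast
      then show ?thesis
        using S_base[OF prime_ideal_compl_mult[OF D P', of s t], of "k + l"]
        by (simp add: power_add ac_simps)
    qed
    moreover have "principal D u \<inter> S = {}"
    proof (rule ccontr)
      assume "\<not> ?thesis"
      then obtain k s where s: "v ^ k * s \<in> principal D u" "s \<in> D - P"
        unfolding S_def by blast
      then have "s / u \<in> D"
        using cancel nz(2) by (simp add: in_principal_iff)
      \<comment> \<open>Here \<open>u\<close> would divide \<open>s\<close>, putting
        \<open>s\<close> into \<open>P\<close>.\<close>
      then have "s / u * u \<in> P"
        by (intro prime_ideal_mult_left[OF P'] uvP)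
      then show False
        using s(2) nz(2) by simp
    qed
    ultimately obtain Q where Q: "is_prime_ideal D Q" "principal D u \<subseteq> Q" "Q \<inter> S = {}"
      using exists_prime_ideal_avoiding[OF D, of "principal D u" S] by blast
    have "Q \<subseteq> P"
      using Q(3) prime_ideal_subset[OF Q(1)] S_base[of _ 0] by auto
    moreover have "u \<in> Q"
      using Q(2) nz(2) subring_one[OF D] by (auto simp: in_principal_iff)
    moreover have "v \<notin> Q"
      using Q(3) S_base[OF one, of 1] by auto
    ultimately show False
      using P Q(1) nz(2) uvP unfolding is_minimal_nonzero_prime_def by blast
  qed
  then show ?thesis
    using root[OF eqs(1) n] root[OF eqs(2) n] uv by blast
qed

end

section \<open>Packets\<close>

context domain_in_field
begin

lemma packetD:
  assumes "is_packet D J"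
  shows "J \<in> invertible_t_ideals" "J \<subseteq> D" "is_prime_ideal D (radical D J)" "J \<subseteq> radical D J"
  using assms subset_radical by (auto simp: is_packet_def invertible_t_ideals_def)

lemma packet_product:
  assumes "\<forall>J\<in>set Is. is_packet D J"
  shows "is_nonzero_frac_ideal D (foldr (ideal_mult D) Is D)"
    and "foldr (ideal_mult D) Is D \<subseteq> D"
    and "\<forall>J\<in>set Is. foldr (ideal_mult D) Is D \<subseteq> J"
proof -
  have "is_nonzero_frac_ideal D (foldr (ideal_mult D) Is D) \<and> foldr (ideal_mult D) Is D \<subseteq> D \<and>
      (\<forall>J\<in>set Is. foldr (ideal_mult D) Is D \<subseteq> J)"
    using assms
  proof (induction Is)
    case (Cons K Is)
    let ?F = "foldr (ideal_mult D) Is D"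
    have IH: "is_nonzero_frac_ideal D ?F" "?F \<subseteq> D" "\<forall>J\<in>set Is. ?F \<subseteq> J"
      using Cons by simp_all
    have "is_packet D K"
      using Cons.prems by simp
    note K = packetD(1,2)[OF this]
    note K_sub = t_closed_submodule[OF invertible_t_idealD(2)[OF K(1)]]
    note F_sub = nonzero_frac_idealD(1)[OF IH(1)]
    have "ideal_mult D K ?F \<subseteq> K"
    proof (rule ideal_mult_least[OF K_sub])
      fix a b assume "a \<in> K" "b \<in> ?F"
      then have "b * a \<in> K"
        using IH(2) by (intro submodule_mult[OF K_sub]) auto
      then show "a * b \<in> K"
        by (simp add: mult.commute)
    qed
    moreover have "ideal_mult D K ?F \<subseteq> ?F"
      using submodule_mult[OF F_sub] K(2) by (intro ideal_mult_least[OF F_sub]) blast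
    ultimately show ?case
      using nonzero_frac_ideal_mult[OF invertible_t_idealD(1)[OF K(1)] IH(1)] IH by fastforce
  qed (simp add: nonzero_frac_ideal_D)
  then show "is_nonzero_frac_ideal D (foldr (ideal_mult D) Is D)"
    and "foldr (ideal_mult D) Is D \<subseteq> D"
    and "\<forall>J\<in>set Is. foldr (ideal_mult D) Is D \<subseteq> J"
    by blast+
qed

lemma prime_contains_packet:
  assumes "\<forall>J\<in>set Is. is_packet D J" "is_prime_ideal D P" "foldr (ideal_mult D) Is D \<subseteq> P"
  shows "\<exists>J\<in>set Is. J \<subseteq> P"
  using assms(1,3)
proof (induction Is)
  case Nil
  then show ?case
    using prime_ideal_one[OF assms(2)] subring_one[OF D] by auto
next
  case (Cons K Is)
  let ?F = "foldr (ideal_mult D) Is D"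
  show ?case
  proof (cases "K \<subseteq> P")
    case False
    then obtain a where a: "a \<in> K" "a \<notin> P"
      by blast
    have "?F \<subseteq> P"
    proof
      fix b assume b: "b \<in> ?F"
      then have "a * b \<in> P"
        using Cons.prems(2) ideal_mult_mem[OF a(1) b] by auto
      moreover have "a \<in> D" "b \<in> D"
        using a(1) b Cons.prems(1) packetD(2)[of K] packet_product(2)[of Is] by auto
      ultimately show "b \<in> P"
        using prime_ideal_cases[OF assms(2)] a(2) by blast
    qed
    then show ?thesis
      using Cons by auto
  qed auto
qed

text \<open>A \<open>t\<close>-product lies in each of its packets, since packets are
  \<open>t\<close>-closed. Conversely the plain product, before taking the \<open>t\<close>-closure,
  lies in (x), hence in any prime containing \<open>x\<close>, which then contains one of the
  factors.\<close>

lemma packet_representation_principal: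
  assumes "is_packet_representation D (principal D x) Is" "x \<noteq> 0"
  shows "J \<in> set Is \<Longrightarrow> x \<in> J"
    and "is_prime_ideal D P \<Longrightarrow> x \<in> P \<Longrightarrow> \<exists>J\<in>set Is. J \<subseteq> P"
proof -
  let ?F = "foldr (ideal_mult D) Is D"
  have Is: "\<forall>J\<in>set Is. is_packet D J" "principal D x = t_closure D ?F"
    using assms(1) by (auto simp: is_packet_representation_def)
  note F = packet_product[OF Is(1)]
  note F_sub = nonzero_frac_idealD(1,2)[OF F(1)]
  have x: "x \<in> principal D x"
    using assms(2) subring_one[OF D] by (simp add: in_principal_iff)
  show "x \<in> J" if "J \<in> set Is"
  proof -
    have "t_closure D ?F \<subseteq> J"
      using that F(3) Is(1) packetD(1) invertible_t_idealD(2) by (intro t_closure_least[OF F_sub(1)]) auto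
    then show ?thesis
      using x Is(2) by blast
  qed
  show "\<exists>J\<in>set Is. J \<subseteq> P" if P: "is_prime_ideal D P" "x \<in> P"
  proof (rule prime_contains_packet[OF Is(1) P(1)])
    have "?F \<subseteq> principal D x"
      using subset_t_closure[OF F_sub] Is(2) by simp
    also have "\<dots> \<subseteq> P"
      using prime_ideal_mult_right[OF P(1) _ P(2)] by (auto simp: principal_def)
    finally show "?F \<subseteq> P" .
  qed
qed

end

locale integrally_closed_AGCD_URD = integrally_closed_AGCD_domain +
  assumes urd: "is_URD D"
begin

lemma exists_packet_representation:
  assumes "x \<in> D" "x \<noteq> 0" "\<not> is_unit_in D x"
  shows "\<exists>Is. is_packet_representation D (principal D x) Is"
proof -
  have "1 \<notin> principal D x"
    using assms by (auto simp: in_principal_iff is_unit_in_def intro!: bexI[of _ "1 / x"])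
  moreover have "principal D x \<subseteq> D"
    using assms(1) by (auto simp: principal_def subring_mult[OF D])
  ultimately have "principal D x \<subset> D"
    using subring_one[OF D] by blast
  then show ?thesis
    using urd principal_invertible[OF assms(2)] unfolding is_URD_def invertible_t_ideals_def by blast
qed

lemma exists_packet_containing:
  assumes "x \<in> D" "x \<noteq> 0" "\<not> is_unit_in D x"
  obtains J where "is_packet D J" "x \<in> J"
proof -
  obtain Is where Is: "is_packet_representation D (principal D x) Is"
    using exists_packet_representation[OF assms] by blast
  then have "hd Is \<in> set Is" "is_packet D (hd Is)"
    by (auto simp: is_packet_representation_def)
  then show ?thesis
    using that packet_representation_principal(1)[OF Is assms(2)] by blast
qed

lemma finite_minimal_primes_containing:
  assumes "x \<in> D" "x \<noteq> 0" "\<not> is_unit_in D x"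
  shows "finite {P. is_minimal_nonzero_prime D P \<and> x \<in> P}"
proof -
  obtain Is where Is: "is_packet_representation D (principal D x) Is"
    using exists_packet_representation[OF assms] by blast
  have "P \<in> radical D ` set Is" if P: "is_minimal_nonzero_prime D P" "x \<in> P" for P
  proof -
    have P': "is_prime_ideal D P"
      using P by (simp add: is_minimal_nonzero_prime_def)
    obtain J where J: "J \<in> set Is" "J \<subseteq> P"
      using packet_representation_principal(2)[OF Is assms(2) P' P(2)] by blast
    have "is_packet D J"
      using Is J(1) by (simp add: is_packet_representation_def)
    note J' = packetD[OF this]
    have "x \<in> radical D J"
      using packet_representation_principal(1)[OF Is assms(2) J(1)] J'(4) by blast
    \<comment> \<open>Nonzero, prime and contained in \<open>P\<close>, the radical equals
      \<open>P\<close> by minimality.\<close>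
    then have "radical D J \<noteq> {0}"
      using assms(2) by blast
    then have "radical D J = P"
      using P(1) J'(3) radical_subset_prime[OF D P' J(2)] unfolding is_minimal_nonzero_prime_def by blast
    then show ?thesis
      using J(1) by blast
  qed
  then have "{P. is_minimal_nonzero_prime D P \<and> x \<in> P} \<subseteq> radical D ` set Is"
    by blast
  then show ?thesis
    by (rule finite_subset) simp
qed

text \<open>
  Let \<open>0 \<noteq> P \<subset> \<surd>I\<close> be prime. Some \<open>t\<close>-power of the packet \<open>I\<close> is principal, say \<open>(q)\<close>. For \<open>z \<in> P\<close>
  write \<open>z\<^sup>k = g u\<close> and \<open>q\<^sup>m\<^sup>k = g v\<close> with \<open>u\<close>, \<open>v\<close> coprime. Then \<open>u \<in> P\<close>, and if \<open>v\<close> were a nonunit,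
  a packet containing \<open>v\<close> would have \<open>q\<close>, hence \<open>\<surd>I\<close>, hence \<open>u\<close> in its radical, which is impossible for
  coprime elements. Thus \<open>q\<^sup>m\<close> divides \<open>z\<close> for all \<open>m\<close>.
\<close>

lemma archimedean_packet_radical_minimal:
  assumes arch: "is_archimedean D" and I: "is_packet D I"
  shows "is_minimal_nonzero_prime D (radical D I)"
proof -
  let ?Q = "radical D I"
  note I' = packetD[OF I]
  note Q = I'(3)
  obtain n q where n: "n \<ge> 1" and q: "q \<in> I" "\<And>a. a \<in> I \<Longrightarrow> a ^ n \<in> principal D q"
    using integral_invertible_power[OF I'(1,2)] by blast
  \<comment> \<open>\<open>q\<close> and \<open>I\<close> lie in the same primes, so the radical of
    the packet is the least prime containing \<open>q\<close>.\<close>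
  have rad_sub: "?Q \<subseteq> P" if P: "is_prime_ideal D P" "q \<in> P" for P
  proof (rule radical_subset_prime[OF D P(1)], rule subsetI)
    fix a assume a: "a \<in> I"
    have "a ^ n \<in> P"
      using q(2)[OF a] prime_ideal_mult_right[OF P(1) _ P(2)] by (auto simp: principal_def)
    then show "a \<in> P"
      using prime_ideal_power[OF D P(1)] a I'(2) by blast
  qed
  have "q \<in> D" "\<not> is_unit_in D q"
    using q(1) I'(2,4) prime_ideal_unit[OF Q] by auto
  have "?Q \<noteq> {0}"
    using I'(4) nonzero_frac_idealD(3)[OF invertible_t_idealD(1)[OF I'(1)]] by blast
  moreover have "P = ?Q" if P: "is_prime_ideal D P" "P \<noteq> {0}" "P \<subseteq> ?Q" for P
  proof (rule ccontr)
    assume "P \<noteq> ?Q"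
    then have "q \<notin> P"
      using rad_sub[OF P(1)] P(3) by blast
    then have "q \<noteq> 0"
      using prime_ideal_zero[OF P(1)] by blast
    obtain z where z: "z \<in> P" "z \<noteq> 0"
      using P(2) prime_ideal_zero[OF P(1)] by blast
    \<comment> \<open>A nonzero element divisible by all powers of the nonunit \<open>q\<close>
      contradicts the Archimedean property.\<close>
    have "z \<in> principal D (q ^ m)" for m
    proof -
      have "q ^ m \<noteq> 0"
        using \<open>q \<noteq> 0\<close> by simp
      obtain k g u v where k: "k \<ge> 1" and uv: "u \<in> D" "v \<in> D" "z ^ k = g * u" "(q ^ m) ^ k = g * v"
        and coprime: "1 \<in> v_closure D {u, v}"
        by (rule exists_coprime_fraction[OF z(2) \<open>q ^ m \<noteq> 0\<close>])
      have "g * v \<noteq> 0"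
        using \<open>q \<noteq> 0\<close> by (simp flip: uv(4))
      then have nz: "g \<noteq> 0" "v \<noteq> 0"
        by auto
      have zk: "z ^ k \<in> P"
        using k z(1) prime_ideal_subset[OF P(1)]
        by (cases k) (auto intro!: prime_ideal_mult_right[OF P(1)] subring_power[OF D])
      have qk: "(q ^ m) ^ k \<in> D"
        using \<open>q \<in> D\<close> by (intro subring_power[OF D])
      have "g * u \<in> D" "g * v \<in> D"
        using zk qk prime_ideal_subset[OF P(1)] uv(3,4) by auto
      then have "\<forall>f\<in>{u, v}. g * f \<in> D"
        by blast
      then have "g * 1 \<in> D"
        using coprime unfolding mem_v_closure by blast
      then have g: "g \<in> D"
        by simp
      \<comment> \<open>\<open>g\<close> divides a power of \<open>q\<close>, which is not in
        \<open>P\<close>; so the factor of z^k that lies in \<open>P\<close> is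
        \<open>u\<close>.\<close>
      have "g \<notin> P"
      proof
        assume "g \<in> P"
        then have "q ^ (m * k) \<in> P"
          using prime_ideal_mult_right[OF P(1) uv(2)] uv(4) by (simp add: power_mult)
        then show False
          using prime_ideal_power[OF D P(1) \<open>q \<in> D\<close>] \<open>q \<notin> P\<close> by blast
      qed
      then have u: "u \<in> P"
        using zk prime_ideal_cases[OF P(1) _ g uv(1)] uv(3) by auto
      have "is_unit_in D v"
      proof (rule ccontr)
        assume "\<not> is_unit_in D v"
        then obtain J where J: "is_packet D J" "v \<in> J"
          using exists_packet_containing[OF uv(2) nz(2)] by blast
        note J' = packetD[OF J(1)]
        have "v \<in> radical D J"
          using J(2) J'(4) by blast
        then have "q ^ (m * k) \<in> radical D J"
          using prime_ideal_mult_left[OF J'(3) g] uv(4) by (simp add: power_mult)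
        then have "q \<in> radical D J"
          by (rule prime_ideal_power[OF D J'(3) \<open>q \<in> D\<close>])
        then have "u \<in> radical D J"
          using rad_sub[OF J'(3)] P(3) u by blast
        then obtain j where j: "j \<ge> 1" "u ^ j \<in> J"
          by (auto simp: radical_def)
        note J_closed = invertible_t_idealD(2)[OF J'(1)]
        \<comment> \<open>The exponent j, chosen for \<open>u\<close>, serves for \<open>v\<close>
          as well since v \<in> J and j \<ge> 1. The j-th powers are still coprime, so the
          \<open>t\<close>-ideal \<open>J\<close> would contain 1.\<close>
        have "v ^ (j - 1) * v \<in> J"
          using J(2) uv(2) by (intro submodule_mult[OF t_closed_submodule[OF J_closed]] subring_power[OF D])
        then have "v ^ j \<in> J"
          using j(1) by (metis One_nat_def Suc_pred less_eq_Suc_le power_Suc2)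
        then have "v_closure D ((\<lambda>b. b ^ j) ` {u, v}) \<subseteq> J"
          using j(2) nz(2) by (intro t_closedD[OF J_closed]) auto
        moreover have "1 \<in> v_closure D ((\<lambda>b. b ^ j) ` {u, v})"
          using uv(1,2) coprime by (intro coprime_powers) auto
        ultimately have "1 \<in> radical D J"
          using J'(4) by blast
        then show False
          using prime_ideal_one[OF J'(3)] by blast
      qed
      then obtain w where w: "w \<in> D" "v * w = 1"
        by (auto simp: is_unit_in_def)
      then have "w = 1 / v"
        using nz(2) by (simp add: field_simps)
      have "(z / q ^ m) ^ k = (g * u) / (g * v)"
        by (simp only: power_divide uv(3,4))
      also have "\<dots> = u * w"
        using nz \<open>w = 1 / v\<close> by simp
      also have "\<dots> \<in> D"
        using uv(1) w(1) by (rule subring_mult[OF D])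
      finally have "z / q ^ m \<in> D"
        using root_closed k by blast
      then show ?thesis
        using \<open>q ^ m \<noteq> 0\<close> by (simp add: in_principal_iff)
    qed
    then have "z \<in> (\<Inter>m\<in>{1..}. principal D (q ^ m))"
      by blast
    then show False
      using arch \<open>q \<in> D\<close> \<open>\<not> is_unit_in D q\<close> z(2) unfolding is_archimedean_def by blast
  qed
  ultimately show ?thesis
    using Q unfolding is_minimal_nonzero_prime_def by blast
qed

lemma archimedean_packet_in_height_one_prime:
  assumes "is_archimedean D" "is_packet D I"
  shows "\<exists>P. is_prime_ideal D P \<and> height D P = 1 \<and> I \<subseteq> P"
  using archimedean_packet_radical_minimal[OF assms] packetD(4)[OF assms(2)]
    minimal_nonzero_prime_height[OF D] by blast

text \<open>Write a power of \<open>x\<close> as u / v with coprime \<open>u\<close>,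
  \<open>v\<close>. A nonunit \<open>v\<close> lies in a packet and so in a prime \<open>P\<close>
  of height one. As x \<in> D_P, u / v = t / s with s \<notin> P, and the multiplier s / v takes
  \<open>u\<close> to \<open>t\<close> and \<open>v\<close> to \<open>s\<close>. Coprimality gives s
  / v \<in> D, whence s \<in> P, a contradiction.\<close>

lemma Inter_localizations:
  assumes packets: "\<And>I. is_packet D I \<Longrightarrow> \<exists>P. is_prime_ideal D P \<and> height D P = 1 \<and> I \<subseteq> P"
  shows "D = \<Inter>(localization D ` {P. is_minimal_nonzero_prime D P})"
proof
  show "D \<subseteq> \<Inter>(localization D ` {P. is_minimal_nonzero_prime D P})"
    using subset_localization[OF D] unfolding is_minimal_nonzero_prime_def by blast
  show "\<Inter>(localization D ` {P. is_minimal_nonzero_prime D P}) \<subseteq> D"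
  proof
    fix x assume x: "x \<in> \<Inter>(localization D ` {P. is_minimal_nonzero_prime D P})"
    show "x \<in> D"
    proof (cases "x = 0")
      case False
      obtain a b where ab: "x = a / b" "a \<in> D" "b \<in> D" "b \<noteq> 0"
        by (rule fractionE)
      then have "a \<noteq> 0"
        using False by auto
      obtain n g u v where n: "n \<ge> 1" and uv: "u \<in> D" "v \<in> D" "a ^ n = g * u" "b ^ n = g * v"
        and coprime: "1 \<in> v_closure D {u, v}"
        by (rule exists_coprime_fraction[OF \<open>a \<noteq> 0\<close> \<open>b \<noteq> 0\<close>])
      have "g * v \<noteq> 0"
        using \<open>b \<noteq> 0\<close> by (simp flip: uv(4))
      then have nz: "g \<noteq> 0" "v \<noteq> 0"
        by auto
      have xn: "x ^ n = u / v"
        using nz uv(3,4) by (simp add: ab(1) power_divide)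
      have "is_unit_in D v"
      proof (rule ccontr)
        assume "\<not> is_unit_in D v"
        then obtain J where J: "is_packet D J" "v \<in> J"
          using exists_packet_containing[OF uv(2) nz(2)] by blast
        then obtain P where P: "is_prime_ideal D P" "height D P = 1" "v \<in> P"
          using packets by blast
        then have "is_minimal_nonzero_prime D P"
          using nz(2) minimal_nonzero_prime_height[OF D] by blast
        then have "x \<in> localization D P"
          using x by blast
        then have "x ^ n \<in> localization D P"
          by (rule subring_power[OF localization_subring[OF D P(1)]])
        then obtain t s where ts: "u / v = t / s" "t \<in> D" "s \<in> D - P"
          unfolding xn localization_def by blast
        then have "s \<noteq> 0"
          using prime_ideal_zero[OF P(1)] by blast
        have "(s / v) * u = t" "(s / v) * v = s"
          using ts(1) nz \<open>s \<noteq> 0\<close> by (simp_all add: field_simps)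
        then have "\<forall>f\<in>{u, v}. (s / v) * f \<in> D"
          using ts by auto
        then have "(s / v) * 1 \<in> D"
          using coprime unfolding mem_v_closure by blast
        then have "(s / v) * v \<in> P"
          using P(3) by (intro prime_ideal_mult_left[OF P(1)]) auto
        then show False
          using ts(3) nz by simp
      qed
      then obtain w where w: "w \<in> D" "v * w = 1"
        by (auto simp: is_unit_in_def)
      then have "w = 1 / v"
        using nz(2) by (simp add: field_simps)
      then have "x ^ n \<in> D"
        using subring_mult[OF D uv(1) w(1)] xn by simp
      then show ?thesis
        using root_closed n by blast
    qed (use subring_zero[OF D] in auto)
  qed
qed

lemma generalized_Krull:
  assumes "\<And>I. is_packet D I \<Longrightarrow> \<exists>P. is_prime_ideal D P \<and> height D P = 1 \<and> I \<subseteq> P"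
  shows "is_generalized_Krull D"
  unfolding is_generalized_Krull_def
proof (intro exI conjI ballI)
  \<comment> \<open>If \<open>D\<close> is a field, this family is empty and its intersection is the
    whole field.\<close>
  let ?\<V> = "localization D ` {P. is_minimal_nonzero_prime D P}"
  show "D = \<Inter>?\<V>"
    by (rule Inter_localizations[OF assms])
  fix V assume "V \<in> ?\<V>"
  then obtain P where P: "is_minimal_nonzero_prime D P" "V = localization D P"
    by blast
  then have P': "is_prime_ideal D P"
    by (simp add: is_minimal_nonzero_prime_def)
  show "is_essential_overring D V"
    using P(2) P' unfolding is_essential_overring_def by blast
  show "is_rank_one_valuation_overring D V"
    unfolding is_rank_one_valuation_overring_def is_valuation_overring_def P(2)
    using localization_subring[OF D P'] subset_localization[OF D P'] localization_valuation[OF P(1)]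
      localization_krull_dim_one[OF D P(1)] by blast
next
  show "is_locally_finite D (localization D ` {P. is_minimal_nonzero_prime D P})"
    unfolding is_locally_finite_def
  proof (intro ballI impI, elim conjE)
    fix x assume x: "x \<in> D" "x \<noteq> 0" "\<not> is_unit_in D x"
    \<comment> \<open>An element of \<open>D\<close> is a nonunit of D_P only if it lies in
      \<open>P\<close>, so the count is over the height-one primes containing it.\<close>
    have "{V \<in> localization D ` {P. is_minimal_nonzero_prime D P}. \<not> is_unit_in V x}
        \<subseteq> localization D ` {P. is_minimal_nonzero_prime D P \<and> x \<in> P}"
      using unit_in_localization_iff[OF D _ x(1)] by (auto simp: is_minimal_nonzero_prime_def)
    then show "finite {V \<in> localization D ` {P. is_minimal_nonzero_prime D P}. \<not> is_unit_in V x}"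
      using finite_minimal_primes_containing[OF x] by (rule finite_subset[OF _ finite_imageI])
  qed
qed

end

theorem theorem4p7:
  fixes D :: "'k::field set"
  assumes "is_subring D" and "quotient_field D = UNIV"
    and "is_AGCD D" and "is_URD D"
  defines "S1 \<equiv> \<exists>\<V>. (\<forall>V\<in>\<V>. is_rank_one_valuation_overring D V) \<and> D = \<Inter>\<V> \<and> is_locally_finite D \<V>"
    and "S2 \<equiv> \<exists>\<V>. (\<forall>V\<in>\<V>. is_rank_one_valuation_overring D V) \<and> D = \<Inter>\<V>"
    and "S3 \<equiv> is_completely_integrally_closed D"
    and "S4 \<equiv> is_integrally_closed (power_series_ring D)"
    and "S5 \<equiv> is_integrally_closed D \<and> is_archimedean D"
    and "S6 \<equiv> is_integrally_closed D \<and>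
               (\<forall>I. is_packet D I \<longrightarrow> (\<exists>P. is_prime_ideal D P \<and> height D P = 1 \<and> I \<subseteq> P))"
    and "S7 \<equiv> is_almost_GUFD D"
  shows "(S1 \<longleftrightarrow> S2) \<and> (S2 \<longleftrightarrow> S3) \<and> (S3 \<longleftrightarrow> S4) \<and> (S4 \<longleftrightarrow> S5) \<and> (S5 \<longleftrightarrow> S6) \<and> (S6 \<longleftrightarrow> S7)"
proof -
  \<comment> \<open>Integral closedness is part of (5) and of (6), so the results on packets are
    available for the implications starting there.\<close>
  have loc: "integrally_closed_AGCD_URD D" if "is_integrally_closed D"
    using assms(1-4) that by unfold_locales
  have "S2" if S1
    using that unfolding S1_def S2_def by blast
  moreover have "S3" if S2
    using that Inter_rank_one_completely_integrally_closed unfolding S2_def S3_def by blast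
  moreover have "S4" if S3
    using that power_series_ring_completely_integrally_closed[OF assms(1,2)]
      completely_integrally_closed_imp_integrally_closed[OF power_series_ring_subring[OF assms(1)]]
    unfolding S3_def S4_def by blast
  moreover have "S5" if S4
    using that integrally_closed_of_power_series_ring[OF assms(1)] archimedean_of_power_series_ring[OF assms(1)]
    unfolding S4_def S5_def by blast
  moreover have "S6" if S5
    using that integrally_closed_AGCD_URD.archimedean_packet_in_height_one_prime[OF loc]
    unfolding S5_def S6_def by blast
  moreover have "S7" if S6
  proof -
    have "is_integrally_closed D"
      using that unfolding S6_def by blast
    then interpret integrally_closed_AGCD_URD D
      by (rule loc)
    have "is_generalized_Krull D"
      using that unfolding S6_def by (intro generalized_Krull) blast
    moreover have "is_torsion_group (t_class_group D)"
      by (rule torsion_t_class_group[OF invertible_power_principal])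
    ultimately show S7
      unfolding S7_def is_almost_GUFD_def by blast
  qed
  moreover have "S1" if S7
    using that unfolding S7_def S1_def is_almost_GUFD_def is_generalized_Krull_def by blast
  ultimately show ?thesis
    by blast
qed

end
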